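(* Let $(\Gamma,\mathbf{q})$ be the polarized metrized graph with $\mathbf{q}=0$ where $\Gamma$ has four vertices $p_1,p_2,p_3,p_4$ and six edges: two parallel edges of lengths $c,d>0$ joining $p_1$ and $p_2$, two parallel edges of lengths $e,f>0$ joining $p_3$ and $p_4$, one edge of length $a>0$ joining $p_2$ and $p_3$, and one edge of length $b>0$ joining $p_4$ and $p_1$. Then $\bar g(\Gamma)=3$, $\ell(\Gamma)=a+b+c+d+e+f$, $\delta_0(\Gamma)=\ell(\Gamma)$, $\delta_1(\Gamma)=0$. Moreover, with $$A=acde+bcde+acdf+bcdf+acef+bcef+adef+bdef,$$ $$B=abce+abde+abcf+abdf,\qquad C=cdef,$$ $$D=(a+b)ce+(a+b)de+cde+(a+b)cf+(a+b)df+cdf+cef+def,$$ one has $$\tau(\Gamma)=\frac{\ell(\Gamma)}{12}-\frac{A+2C}{6D},\qquad \theta(\Gamma)=\frac{6A+8B+8C}{D},\qquad \varphi(\Gamma)=\frac{\ell(\Gamma)}{9}-\frac{2A-6B+7C}{9D},$$ $$\lambda(\Gamma)=\frac{3\,\ell(\Gamma)}{28}+\frac{A+4B}{28D},\qquad \epsilon(\Gamma)=\frac29\ell(\Gamma)+\frac{5A+12B+4C}{9D}.$$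
   Context: A metrized graph $\Gamma$ is a finite connected graph in which each edge $e_i$ is identified with a segment of positive length $L_i$ (multiple edges allowed); $\upsilon(p)$ is the number of directions emanating from $p\in\Gamma$; $V(\Gamma)$ is the vertex set; $\ell(\Gamma)=\sum_i L_i$; $g(\Gamma)=e-v+1$ is the first Betti number ($e$ edges, $v$ vertices). For $\mathbf{q}:\Gamma\to\mathbb{N}=\{0,1,2,\dots\}$ supported on vertices, the canonical divisor is $K=\sum_{p\in V(\Gamma)}(\upsilon(p)-2+2\mathbf{q}(p))\,p$; $(\Gamma,\mathbf{q})$ is a polarized metrized graph if all coefficients of $K$ are $\ge0$, and its genus is $\bar g=\bar g(\Gamma)=g(\Gamma)+\sum_p\mathbf{q}(p)$. $r(x,y)$ is the resistance function: the effective resistance between $x$ and $y$ when $\Gamma$ is viewed as an electrical circuit in which a segment of length $L$ is a resistor of resistance $L$. The tau constant is $\tau(\Gamma)=\frac14\int_\Gamma\big(\frac{\partial}{\partial x}r(x,y)\big)^2dx$ (independent of the fixed $y\in\Gamma$), and $$\theta(\Gamma)=\sum_{p,q\in V(\Gamma)}(\upsilon(p)-2+2\mathbf{q}(p))(\upsilon(q)-2+2\mathbf{q}(q))\,r(p,q)$$ (sum over ordered pairs). Let $\delta_K=\sum_p(\upsilon(p)-2+2\mathbf{q}(p))\delta_p$, with $\delta_p$ the Dirac measure at $p$. The admissible measure associated to $K$ (Zhang) is $$\mu_{ad}=\frac1{\bar g}\Big(\sum_{p\in V(\Gamma)}\mathbf{q}(p)\delta_p+\sum_{e_i}\frac{dx|_{e_i}}{L_i+R_i}\Big),$$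 where $R_i$ is the effective resistance between the end points of $e_i$ in the graph obtained by deleting the interior of $e_i$ ($R_i=\infty$ for a bridge). The invariants are $$\epsilon(\Gamma)=\iint_{\Gamma\times\Gamma} r(x,y)\,\delta_K(x)\,\mu_{ad}(y),\qquad Z(\Gamma)=\frac12\iint_{\Gamma\times\Gamma} r(x,y)\,\mu_{ad}(x)\,\mu_{ad}(y),$$ $$\varphi(\Gamma)=3\bar g\,Z(\Gamma)-\frac14\big(\epsilon(\Gamma)+\ell(\Gamma)\big),\qquad \lambda(\Gamma)=\frac{\bar g-1}{6(2\bar g+1)}\varphi(\Gamma)+\frac1{12}\big(\epsilon(\Gamma)+\ell(\Gamma)\big).$$ For $p\in\Gamma\setminus V(\Gamma)$, let $\Gamma\text{-}p$ be obtained by cutting $\Gamma$ at $p$ (removing $p$ and adding two end points to close the remaining parts). The point $p$ is of type $0$ if $\Gamma\text{-}p$ is connected; otherwise $\Gamma\text{-}p$ is a union of two polarized subgraphs (with $\mathbf{q}$ restricted and equal to $0$ at the new end points) of genera $i$ and $\bar g-i$ with $0<i\le\bar g/2$, and $p$ is of type $i$. $\delta_i(\Gamma)$ is the total length of the set of points of type $i$ (for $\bar g=3$ only $i=0,1$ occur). *)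

theory Defs
  imports "HOL-Analysis.Analysis" "Graph_Theory.Digraph_Component"
begin

section \<open>Resistor networks\<close>

text \<open>
  An undirected multigraph is represented by a \<^typ>\<open>('a, 'b) pre_digraph\<close> whose arcs carry an
  arbitrary orientation; every notion below is independent of that orientation.
\<close>

definition net_current :: "('a, 'b) pre_digraph \<Rightarrow> ('b \<Rightarrow> real) \<Rightarrow> ('a \<Rightarrow> real) \<Rightarrow> 'a \<Rightarrow> real" where
  "net_current G R h v =
     (\<Sum>a | a \<in> arcs G \<and> tail G a = v. (h v - h (head G a)) / R a) +
     (\<Sum>a | a \<in> arcs G \<and> head G a = v. (h v - h (tail G a)) / R a)"

text \<open>Potentials for which a unit current enters the network at \<open>p\<close> and leaves it at \<open>q\<close>
  (Ohm's and Kirchhoff's laws).\<close>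

definition unit_potential ::
    "('a, 'b) pre_digraph \<Rightarrow> ('b \<Rightarrow> real) \<Rightarrow> 'a \<Rightarrow> 'a \<Rightarrow> ('a \<Rightarrow> real) \<Rightarrow> bool" where
  "unit_potential G R p q h \<longleftrightarrow>
     (\<forall>v\<in>verts G. net_current G R h v = of_bool (v = p) - of_bool (v = q))"

text \<open>The value is infinite exactly if \<open>p\<close> and \<open>q\<close> lie in different components.\<close>

definition eff_resistance ::
    "('a, 'b) pre_digraph \<Rightarrow> ('b \<Rightarrow> real) \<Rightarrow> 'a \<Rightarrow> 'a \<Rightarrow> ereal" where
  "eff_resistance G R p q =
     (if \<exists>h. unit_potential G R p q h
      then ereal (THE r. \<exists>h. unit_potential G R p q h \<and> r = h p - h q)
      else \<infinity>)"


section \<open>Polarized metrized graphs\<close>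

record ('v, 'e) metrized =
  gr :: "('v, 'e) pre_digraph"
  len :: "'e \<Rightarrow> real"
  pol :: "'v \<Rightarrow> nat"

definition metrized_graph :: "('v, 'e) metrized \<Rightarrow> bool" where
  "metrized_graph \<Gamma> \<longleftrightarrow>
     fin_digraph (gr \<Gamma>) \<and> Digraph_Component.connected (gr \<Gamma>) \<and> (\<forall>e\<in>arcs (gr \<Gamma>). 0 < len \<Gamma> e)"

text \<open>A self-loop contributes two directions.\<close>

definition valence :: "('v, 'e) metrized \<Rightarrow> 'v \<Rightarrow> nat" where
  "valence \<Gamma> p = card {e \<in> arcs (gr \<Gamma>). tail (gr \<Gamma>) e = p} + card {e \<in> arcs (gr \<Gamma>). head (gr \<Gamma>) e = p}"

definition total_length :: "('v, 'e) metrized \<Rightarrow> real" where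
  "total_length \<Gamma> = (\<Sum>e\<in>arcs (gr \<Gamma>). len \<Gamma> e)"

definition betti :: "('v, 'e) metrized \<Rightarrow> int" where
  "betti \<Gamma> = int (card (arcs (gr \<Gamma>))) - int (card (verts (gr \<Gamma>))) + 1"

definition genus :: "('v, 'e) metrized \<Rightarrow> int" where
  "genus \<Gamma> = betti \<Gamma> + (\<Sum>p\<in>verts (gr \<Gamma>). int (pol \<Gamma> p))"

definition canonical :: "('v, 'e) metrized \<Rightarrow> 'v \<Rightarrow> int" where
  "canonical \<Gamma> p = int (valence \<Gamma> p) - 2 + 2 * int (pol \<Gamma> p)"

definition polarized_metrized_graph :: "('v, 'e) metrized \<Rightarrow> bool" where
  "polarized_metrized_graph \<Gamma> \<longleftrightarrow>
     metrized_graph \<Gamma> \<and> (\<forall>p\<in>verts (gr \<Gamma>). 0 \<le> canonical \<Gamma> p)"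


section \<open>Points of a metrized graph and the resistance function\<close>

text \<open>\<open>Inner e t\<close> is the point of the open edge \<open>e\<close> at distance \<open>t\<close> from \<open>tail e\<close>.\<close>

datatype ('v, 'e) point = Vertex 'v | Inner 'e real

definition points :: "('v, 'e) metrized \<Rightarrow> ('v, 'e) point set" where
  "points \<Gamma> = Vertex ` verts (gr \<Gamma>) \<union> {Inner e t | e t. e \<in> arcs (gr \<Gamma>) \<and> 0 < t \<and> t < len \<Gamma> e}"

definition edge_point :: "('v, 'e) metrized \<Rightarrow> 'e \<Rightarrow> real \<Rightarrow> ('v, 'e) point" where
  "edge_point \<Gamma> e t =
     (if t = 0 then Vertex (tail (gr \<Gamma>) e)
      else if t = len \<Gamma> e then Vertex (head (gr \<Gamma>) e)
      else Inner e t)"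

text \<open>Subdivision of the circuit at the points in \<open>S\<close>: the arc \<open>(e, s, t)\<close> is the segment of \<open>e\<close>
  between two consecutive parameters \<open>s < t\<close>, a resistor of resistance \<open>t - s\<close>.\<close>

definition marks :: "('v, 'e) metrized \<Rightarrow> ('v, 'e) point set \<Rightarrow> 'e \<Rightarrow> real set" where
  "marks \<Gamma> S e = {0, len \<Gamma> e} \<union> {t. 0 < t \<and> t < len \<Gamma> e \<and> Inner e t \<in> S}"

definition subdivision ::
    "('v, 'e) metrized \<Rightarrow> ('v, 'e) point set \<Rightarrow> (('v, 'e) point, 'e \<times> real \<times> real) pre_digraph" where
  "subdivision \<Gamma> S =
     \<lparr> verts = Vertex ` verts (gr \<Gamma>) \<union> S,
       arcs = {(e, s, t). e \<in> arcs (gr \<Gamma>) \<and> s \<in> marks \<Gamma> S e \<and> t \<in> marks \<Gamma> S e \<and> s < t \<and>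
                 (\<forall>u\<in>marks \<Gamma> S e. \<not> (s < u \<and> u < t))},
       tail = (\<lambda>(e, s, t). edge_point \<Gamma> e s),
       head = (\<lambda>(e, s, t). edge_point \<Gamma> e t) \<rparr>"

definition resistance :: "('v, 'e) metrized \<Rightarrow> ('v, 'e) point \<Rightarrow> ('v, 'e) point \<Rightarrow> real" where
  "resistance \<Gamma> x y =
     real_of_ereal (eff_resistance (subdivision \<Gamma> {x, y}) (\<lambda>(e, s, t). t - s) x y)"

definition deleted_resistance :: "('v, 'e) metrized \<Rightarrow> 'e \<Rightarrow> ereal" where
  "deleted_resistance \<Gamma> e =
     eff_resistance (pre_digraph.del_arc (gr \<Gamma>) e) (len \<Gamma>) (tail (gr \<Gamma>) e) (head (gr \<Gamma>) e)"


section \<open>Measures on a metrized graph\<close>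

definition borel_sets :: "('v, 'e) metrized \<Rightarrow> ('v, 'e) point set set" where
  "borel_sets \<Gamma> =
     {A. A \<subseteq> points \<Gamma> \<and>
         (\<forall>e\<in>arcs (gr \<Gamma>). {t. 0 < t \<and> t < len \<Gamma> e \<and> Inner e t \<in> A} \<in> sets borel)}"

text \<open>Point masses \<open>m p\<close> at the vertices plus \<open>\<rho> e\<close> times the length measure on each edge \<open>e\<close>,
  for nonnegative \<open>m\<close> and \<open>\<rho>\<close> (\<^const>\<open>ennreal\<close> would truncate negative weights to \<open>0\<close>).\<close>

definition graph_measure ::
    "('v, 'e) metrized \<Rightarrow> ('v \<Rightarrow> real) \<Rightarrow> ('e \<Rightarrow> real) \<Rightarrow> ('v, 'e) point measure" where
  "graph_measure \<Gamma> m \<rho> = measure_of (points \<Gamma>) (borel_sets \<Gamma>)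
     (\<lambda>A. (\<Sum>p\<in>verts (gr \<Gamma>). ennreal (m p) * indicator A (Vertex p)) +
          (\<Sum>e\<in>arcs (gr \<Gamma>). ennreal (\<rho> e) *
             emeasure lborel {t. 0 < t \<and> t < len \<Gamma> e \<and> Inner e t \<in> A}))"

definition length_measure :: "('v, 'e) metrized \<Rightarrow> ('v, 'e) point measure" where
  "length_measure \<Gamma> = graph_measure \<Gamma> (\<lambda>_. 0) (\<lambda>_. 1)"

definition canonical_measure :: "('v, 'e) metrized \<Rightarrow> ('v, 'e) point measure" where
  "canonical_measure \<Gamma> = graph_measure \<Gamma> (\<lambda>p. of_int (canonical \<Gamma> p)) (\<lambda>_. 0)"

text \<open>For a bridge the density vanishes, since \<open>1 / \<infinity> = 0\<close> in \<^typ>\<open>ereal\<close>.\<close>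

definition admissible_measure :: "('v, 'e) metrized \<Rightarrow> ('v, 'e) point measure" where
  "admissible_measure \<Gamma> = graph_measure \<Gamma>
     (\<lambda>p. real (pol \<Gamma> p) / of_int (genus \<Gamma>))
     (\<lambda>e. real_of_ereal (1 / (ereal (len \<Gamma> e) + deleted_resistance \<Gamma> e)) / of_int (genus \<Gamma>))"


section \<open>Invariants\<close>

text \<open>The value at the vertices is irrelevant: they form a null set for the length measure.\<close>

definition resistance_deriv :: "('v, 'e) metrized \<Rightarrow> ('v, 'e) point \<Rightarrow> ('v, 'e) point \<Rightarrow> real" where
  "resistance_deriv \<Gamma> y x =
     (case x of Vertex p \<Rightarrow> 0 | Inner e t \<Rightarrow> deriv (\<lambda>s. resistance \<Gamma> (Inner e s) y) t)"

text \<open>The value does not depend on the base point \<open>y\<close>.\<close>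

definition tau :: "('v, 'e) metrized \<Rightarrow> ('v, 'e) point \<Rightarrow> real" where
  "tau \<Gamma> y = 1 / 4 * (\<integral>x. (resistance_deriv \<Gamma> y x)\<^sup>2 \<partial>length_measure \<Gamma>)"

definition theta :: "('v, 'e) metrized \<Rightarrow> real" where
  "theta \<Gamma> = (\<Sum>p\<in>verts (gr \<Gamma>). \<Sum>q\<in>verts (gr \<Gamma>).
     of_int (canonical \<Gamma> p) * of_int (canonical \<Gamma> q) * resistance \<Gamma> (Vertex p) (Vertex q))"

definition epsilon_inv :: "('v, 'e) metrized \<Rightarrow> real" where
  "epsilon_inv \<Gamma> = (\<integral>y. (\<integral>x. resistance \<Gamma> x y \<partial>canonical_measure \<Gamma>) \<partial>admissible_measure \<Gamma>)"

definition Z_inv :: "('v, 'e) metrized \<Rightarrow> real" where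
  "Z_inv \<Gamma> = 1 / 2 * (\<integral>y. (\<integral>x. resistance \<Gamma> x y \<partial>admissible_measure \<Gamma>) \<partial>admissible_measure \<Gamma>)"

definition phi_inv :: "('v, 'e) metrized \<Rightarrow> real" where
  "phi_inv \<Gamma> = 3 * of_int (genus \<Gamma>) * Z_inv \<Gamma> - 1 / 4 * (epsilon_inv \<Gamma> + total_length \<Gamma>)"

definition lambda_inv :: "('v, 'e) metrized \<Rightarrow> real" where
  "lambda_inv \<Gamma> = (of_int (genus \<Gamma>) - 1) / (6 * (2 * of_int (genus \<Gamma>) + 1)) * phi_inv \<Gamma> +
     1 / 12 * (epsilon_inv \<Gamma> + total_length \<Gamma>)"


section \<open>Types of points\<close>

text \<open>Cutting \<open>\<Gamma>\<close> at \<open>Inner e t\<close>: the new end points are \<open>Inr False\<close> (on the side of \<open>tail e\<close>) and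
  \<open>Inr True\<close> (on the side of \<open>head e\<close>), and so are the two remaining pieces of \<open>e\<close>.\<close>

definition cut :: "('v, 'e) metrized \<Rightarrow> 'e \<Rightarrow> real \<Rightarrow> ('v + bool, 'e + bool) metrized" where
  "cut \<Gamma> e t =
     \<lparr> gr =
         \<lparr> verts = Inl ` verts (gr \<Gamma>) \<union> {Inr False, Inr True},
           arcs = Inl ` (arcs (gr \<Gamma>) - {e}) \<union> {Inr False, Inr True},
           tail = (\<lambda>a. case a of Inl a' \<Rightarrow> Inl (tail (gr \<Gamma>) a')
                     | Inr s \<Rightarrow> if s then Inr True else Inl (tail (gr \<Gamma>) e)),
           head = (\<lambda>a. case a of Inl a' \<Rightarrow> Inl (head (gr \<Gamma>) a')
                     | Inr s \<Rightarrow> if s then Inl (head (gr \<Gamma>) e) else Inr False) \<rparr>,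
       len = (\<lambda>a. case a of Inl a' \<Rightarrow> len \<Gamma> a' | Inr s \<Rightarrow> if s then len \<Gamma> e - t else t),
       pol = (\<lambda>v. case v of Inl p \<Rightarrow> pol \<Gamma> p | Inr s \<Rightarrow> 0) \<rparr>"

definition restrict_to :: "('v, 'e) metrized \<Rightarrow> 'v set \<Rightarrow> ('v, 'e) metrized" where
  "restrict_to \<Gamma> W = \<Gamma>\<lparr>gr := gr \<Gamma> \<restriction> W\<rparr>"

definition splits_into :: "('v, 'e) metrized \<Rightarrow> 'v set \<Rightarrow> 'v set \<Rightarrow> bool" where
  "splits_into \<Gamma> W1 W2 \<longleftrightarrow>
     W1 \<union> W2 = verts (gr \<Gamma>) \<and> W1 \<inter> W2 = {} \<and>
     (\<forall>a\<in>arcs (gr \<Gamma>). tail (gr \<Gamma>) a \<in> W1 \<longleftrightarrow> head (gr \<Gamma>) a \<in> W1) \<and>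
     metrized_graph (restrict_to \<Gamma> W1) \<and> metrized_graph (restrict_to \<Gamma> W2)"

definition has_type :: "('v, 'e) metrized \<Rightarrow> ('v, 'e) point \<Rightarrow> nat \<Rightarrow> bool" where
  "has_type \<Gamma> x i \<longleftrightarrow> (\<exists>e t. x = Inner e t \<and> x \<in> points \<Gamma> \<and>
     (if i = 0 then Digraph_Component.connected (gr (cut \<Gamma> e t))
      else \<not> Digraph_Component.connected (gr (cut \<Gamma> e t)) \<and> 2 * int i \<le> genus \<Gamma> \<and>
        (\<exists>W1 W2. splits_into (cut \<Gamma> e t) W1 W2 \<and>
           genus (restrict_to (cut \<Gamma> e t) W1) = int i \<and>
           genus (restrict_to (cut \<Gamma> e t) W2) = genus \<Gamma> - int i)))"

definition delta_inv :: "('v, 'e) metrized \<Rightarrow> nat \<Rightarrow> real" where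
  "delta_inv \<Gamma> i = measure (length_measure \<Gamma>) {x \<in> points \<Gamma>. has_type \<Gamma> x i}"


section \<open>The graph with two double edges\<close>

datatype vertex4 = P1 | P2 | P3 | P4

datatype edge6 = EdgeA | EdgeB | EdgeC | EdgeD | EdgeE | EdgeF

fun edge6_tail :: "edge6 \<Rightarrow> vertex4" where
  "edge6_tail EdgeA = P2"
| "edge6_tail EdgeB = P4"
| "edge6_tail EdgeC = P1"
| "edge6_tail EdgeD = P1"
| "edge6_tail EdgeE = P3"
| "edge6_tail EdgeF = P3"

fun edge6_head :: "edge6 \<Rightarrow> vertex4" where
  "edge6_head EdgeA = P3"
| "edge6_head EdgeB = P1"
| "edge6_head EdgeC = P2"
| "edge6_head EdgeD = P2"
| "edge6_head EdgeE = P4"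
| "edge6_head EdgeF = P4"

definition two_double_edges ::
    "real \<Rightarrow> real \<Rightarrow> real \<Rightarrow> real \<Rightarrow> real \<Rightarrow> real \<Rightarrow> (vertex4, edge6) metrized" where
  "two_double_edges a b c d e f =
     \<lparr> gr = \<lparr> verts = UNIV, arcs = UNIV, tail = edge6_tail, head = edge6_head \<rparr>,
       len = (\<lambda>x. case x of EdgeA \<Rightarrow> a | EdgeB \<Rightarrow> b | EdgeC \<Rightarrow> c | EdgeD \<Rightarrow> d | EdgeE \<Rightarrow> e | EdgeF \<Rightarrow> f),
       pol = (\<lambda>_. 0) \<rparr>"

end

theory Submission
  imports Defs
begin

text \<open>
  The resistance function of a metrized graph is determined by its values at pairs of vertices: as a
  function of one point it has constant second derivative \<open>- 2 / (L + R)\<close> on every edge, so it is a linear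
  interpolation of vertex values plus an explicit parabola, plus the Green function of a segment when
  both points lie on the same edge. Such a closed form is verified rather than derived
  (\<open>resistance_eq_kernel\<close>): by reciprocity any potential with the right currents computes the effective
  resistance (\<open>eff_resistance_eq\<close>), and half the difference of two kernels has the right currents in the
  subdivided circuit.

  The closed form yields \<open>tau\<close> as a sum over edges and vertices (\<open>tau_eq\<close>). It also shows that the
  resistance function integrates to \<open>2 * tau \<Gamma> y\<close>, the same value for all \<open>y\<close>, against the canonical measure
  \<open>\<mu>\<^sub>c\<^sub>a\<^sub>n\<close>, which has density \<open>1 / (L + R)\<close> on edges and mass \<open>1 - valence \<Gamma> p / 2\<close> at vertices
  (\<open>density_integral\<close>). Since \<open>genus \<Gamma>\<close> times \<open>\<mu>\<^sub>a\<^sub>d\<close> equals \<open>\<mu>\<^sub>c\<^sub>a\<^sub>n\<close> plus half the canonical divisor, both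
  \<open>epsilon_inv\<close> and \<open>Z_inv\<close> are combinations of \<open>tau\<close> and \<open>theta\<close> (\<open>epsilon_eq\<close>, \<open>Z_eq\<close>), and so are
  \<open>phi_inv\<close> and \<open>lambda_inv\<close>.

  For the graph with two double edges it remains to know the six resistances between vertices. Replacing
  each parallel pair by one resistor, \<open>u = c * d / (c + d)\<close> and \<open>w = e * f / (e + f)\<close>, leaves a loop of length
  \<open>S = u + a + w + b\<close>, on which the resistance between two points at distance \<open>t\<close> is \<open>t * (S - t) / S\<close>. No cut
  at an interior point disconnects the graph, so all interior points are of type \<open>0\<close>.
\<close>

section \<open>Effective resistance and reciprocity\<close>

lemma sum_net_current:
  assumes "fin_digraph G"
  shows "(\<Sum>v\<in>verts G. g v * net_current G R h v) =
         (\<Sum>a\<in>arcs G. (g (tail G a) - g (head G a)) * (h (tail G a) - h (head G a)) / R a)"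
proof -
  interpret fin_digraph G by fact
  have 1: "(\<Sum>v\<in>verts G. \<Sum>a | a \<in> arcs G \<and> tail G a = v. g v * ((h v - h (head G a)) / R a)) =
           (\<Sum>a\<in>arcs G. g (tail G a) * ((h (tail G a) - h (head G a)) / R a))"
    by (subst sum.group[where g = "tail G" and T = "verts G" and S = "arcs G", symmetric])
       (auto intro!: sum.cong)
  have 2: "(\<Sum>v\<in>verts G. \<Sum>a | a \<in> arcs G \<and> head G a = v. g v * ((h v - h (tail G a)) / R a)) =
           (\<Sum>a\<in>arcs G. g (head G a) * ((h (head G a) - h (tail G a)) / R a))"
    by (subst sum.group[where g = "head G" and T = "verts G" and S = "arcs G", symmetric])
       (auto intro!: sum.cong)
  show ?thesis
    unfolding net_current_def distrib_left sum.distrib sum_distrib_left 1 2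
    unfolding sum.distrib[symmetric] by (intro sum.cong refl) (simp add: divide_inverse algebra_simps)
qed

text \<open>Green's identity exhibits the pairing of potentials as a symmetric form. Reciprocity alone makes the
  potential difference of a unit current well defined, with no appeal to connectedness or to
  positivity of the resistances, so exhibiting one potential computes an effective resistance.\<close>

lemma net_current_reciprocity:
  assumes "fin_digraph G"
  shows "(\<Sum>v\<in>verts G. g v * net_current G R h v) = (\<Sum>v\<in>verts G. h v * net_current G R g v)"
  unfolding sum_net_current[OF assms] by (simp add: mult.commute)

lemma eff_resistance_eq:
  assumes G: "fin_digraph G" and pq: "p \<in> verts G" "q \<in> verts G" and h: "unit_potential G R p q h"
  shows "eff_resistance G R p q = ereal (h p - h q)"
proof -
  interpret fin_digraph G by fact
  have pair: "(\<Sum>v\<in>verts G. k v * net_current G R l v) = k p - k q" if "unit_potential G R p q l" for k l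
  proof -
    have "(\<Sum>v\<in>verts G. k v * net_current G R l v) =
          (\<Sum>v\<in>verts G. k v * of_bool (v = p) - k v * of_bool (v = q))"
      using that by (intro sum.cong refl) (simp add: unit_potential_def right_diff_distrib)
    also have "\<dots> = k p - k q"
      using pq by (simp add: sum_subtractf of_bool_def if_distrib[of "(*) _"] cong: if_cong)
    finally show ?thesis .
  qed
  have "k p - k q = h p - h q" if "unit_potential G R p q k" for k
    using pair[OF that, of h] pair[OF h, of k] net_current_reciprocity[OF G, of h R k] by simp
  then have "(THE r. \<exists>k. unit_potential G R p q k \<and> r = k p - k q) = h p - h q"
    using h by (intro the_equality) blast+
  moreover have "\<exists>k. unit_potential G R p q k"
    using h by blast
  ultimately show ?thesis
    by (simp only: eff_resistance_def if_True)
qed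

section \<open>Integration on a metrized graph\<close>

abbreviation open_edge :: "('v, 'e) metrized \<Rightarrow> 'e \<Rightarrow> real measure" where
  "open_edge \<Gamma> e \<equiv> restrict_space lborel {0<..<len \<Gamma> e}"

lemma sigma_algebra_borel_sets: "sigma_algebra (points \<Gamma>) (borel_sets \<Gamma>)"
  unfolding sigma_algebra_iff2
proof (intro conjI ballI allI impI)
  show "borel_sets \<Gamma> \<subseteq> Pow (points \<Gamma>)" "{} \<in> borel_sets \<Gamma>"
    by (auto simp: borel_sets_def)
next
  fix A assume A: "A \<in> borel_sets \<Gamma>"
  have "{t. 0 < t \<and> t < len \<Gamma> e \<and> Inner e t \<in> points \<Gamma> - A} =
        {0<..<len \<Gamma> e} - {t. 0 < t \<and> t < len \<Gamma> e \<and> Inner e t \<in> A}" if "e \<in> arcs (gr \<Gamma>)" for e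
    using that by (auto simp: points_def)
  with A show "points \<Gamma> - A \<in> borel_sets \<Gamma>"
    by (auto simp: borel_sets_def)
next
  fix A :: "nat \<Rightarrow> _" assume A: "range A \<subseteq> borel_sets \<Gamma>"
  have "{t. 0 < t \<and> t < len \<Gamma> e \<and> Inner e t \<in> (\<Union>i. A i)} =
        (\<Union>i. {t. 0 < t \<and> t < len \<Gamma> e \<and> Inner e t \<in> A i})" for e
    by auto
  moreover have "A i \<in> borel_sets \<Gamma>" for i using A by auto
  ultimately show "(\<Union>i. A i) \<in> borel_sets \<Gamma>"
    by (fastforce simp: borel_sets_def)
qed

lemma space_graph_measure[simp]: "space (graph_measure \<Gamma> m \<rho>) = points \<Gamma>"
  using sigma_algebra_borel_sets[of \<Gamma>] unfolding graph_measure_def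
  by (intro space_measure_of) (auto simp: borel_sets_def)

lemma sets_graph_measure[simp]: "sets (graph_measure \<Gamma> m \<rho>) = borel_sets \<Gamma>"
  unfolding graph_measure_def by (rule sigma_algebra.sets_measure_of_eq[OF sigma_algebra_borel_sets])

lemma emeasure_graph_measure:
  assumes fin: "fin_digraph (gr \<Gamma>)" and A: "A \<in> borel_sets \<Gamma>"
  shows "emeasure (graph_measure \<Gamma> m \<rho>) A =
     (\<Sum>p\<in>verts (gr \<Gamma>). ennreal (m p) * indicator A (Vertex p)) +
     (\<Sum>e\<in>arcs (gr \<Gamma>). ennreal (\<rho> e) * emeasure lborel {t. 0 < t \<and> t < len \<Gamma> e \<and> Inner e t \<in> A})"
    (is "_ = ?\<mu> A")
proof (rule emeasure_measure_of[OF graph_measure_def])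
  show "borel_sets \<Gamma> \<subseteq> Pow (points \<Gamma>)"
    by (auto simp: borel_sets_def)
  show "A \<in> sets (graph_measure \<Gamma> m \<rho>)"
    using A by simp
  show "positive (sets (graph_measure \<Gamma> m \<rho>)) ?\<mu>"
    by (simp add: positive_def)
  show "countably_additive (sets (graph_measure \<Gamma> m \<rho>)) ?\<mu>"
  proof (rule countably_additiveI)
    fix B :: "nat \<Rightarrow> ('a, 'b) point set"
    assume B: "range B \<subseteq> sets (graph_measure \<Gamma> m \<rho>)" and disj: "disjoint_family B"
    have trace: "(\<Sum>i. emeasure lborel {t. 0 < t \<and> t < len \<Gamma> e \<and> Inner e t \<in> B i}) =
        emeasure lborel {t. 0 < t \<and> t < len \<Gamma> e \<and> Inner e t \<in> (\<Union>i. B i)}"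
      if "e \<in> arcs (gr \<Gamma>)" for e
    proof -
      have "(\<Sum>i. emeasure lborel {t. 0 < t \<and> t < len \<Gamma> e \<and> Inner e t \<in> B i}) =
        emeasure lborel (\<Union>i. {t. 0 < t \<and> t < len \<Gamma> e \<and> Inner e t \<in> B i})"
      proof (rule suminf_emeasure)
        show "range (\<lambda>i. {t. 0 < t \<and> t < len \<Gamma> e \<and> Inner e t \<in> B i}) \<subseteq> sets lborel"
          using B that by (auto simp: borel_sets_def)
        show "disjoint_family (\<lambda>i. {t. 0 < t \<and> t < len \<Gamma> e \<and> Inner e t \<in> B i})"
          using disj by (fastforce simp: disjoint_family_on_def)
      qed
      also have "(\<Union>i. {t. 0 < t \<and> t < len \<Gamma> e \<and> Inner e t \<in> B i}) =
          {t. 0 < t \<and> t < len \<Gamma> e \<and> Inner e t \<in> (\<Union>i. B i)}"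
        by auto
      finally show ?thesis .
    qed
    show "(\<Sum>i. ?\<mu> (B i)) = ?\<mu> (\<Union>i. B i)"
      by (subst suminf_add[symmetric], simp, simp)
         (simp add: suminf_sum suminf_indicator[OF disj] trace cong: sum.cong)
  qed
qed

lemma measurable_Inner[measurable (raw)]:
  assumes "e \<in> arcs (gr \<Gamma>)"
  shows "Inner e \<in> measurable (open_edge \<Gamma> e) (graph_measure \<Gamma> m \<rho>)"
proof (rule measurableI)
  show "Inner e t \<in> space (graph_measure \<Gamma> m \<rho>)" if "t \<in> space (open_edge \<Gamma> e)" for t
    using assms that by (auto simp: points_def space_restrict_space)
  fix A assume A: "A \<in> sets (graph_measure \<Gamma> m \<rho>)"
  have "Inner e -` A \<inter> space (open_edge \<Gamma> e) = {t. 0 < t \<and> t < len \<Gamma> e \<and> Inner e t \<in> A}"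
    by (auto simp: space_restrict_space)
  with A assms show "Inner e -` A \<inter> space (open_edge \<Gamma> e) \<in> sets (open_edge \<Gamma> e)"
    by (subst sets_restrict_space_iff) (auto simp: borel_sets_def)
qed

lemma measurable_graph_measure:
  assumes "\<And>e. e \<in> arcs (gr \<Gamma>) \<Longrightarrow> (\<lambda>t. f (Inner e t)) \<in> measurable (open_edge \<Gamma> e) N"
    and "\<And>x. x \<in> points \<Gamma> \<Longrightarrow> f x \<in> space N"
  shows "f \<in> measurable (graph_measure \<Gamma> m \<rho>) N"
proof (rule measurableI)
  fix A assume A: "A \<in> sets N"
  have "{t. 0 < t \<and> t < len \<Gamma> e \<and> Inner e t \<in> f -` A \<inter> points \<Gamma>} \<in> sets borel"
    if e: "e \<in> arcs (gr \<Gamma>)" for e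
  proof -
    have "{t. 0 < t \<and> t < len \<Gamma> e \<and> Inner e t \<in> f -` A \<inter> points \<Gamma>} =
       (\<lambda>t. f (Inner e t)) -` A \<inter> space (open_edge \<Gamma> e)"
      using e by (auto simp: points_def space_restrict_space)
    also have "\<dots> \<in> sets (open_edge \<Gamma> e)"
      using assms(1)[OF e] A by (rule measurable_sets)
    finally show ?thesis
      by (subst (asm) sets_restrict_space_iff) auto
  qed
  then show "f -` A \<inter> space (graph_measure \<Gamma> m \<rho>) \<in> sets (graph_measure \<Gamma> m \<rho>)"
    by (simp add: borel_sets_def)
qed (use assms(2) in simp)

text \<open>The measure is a finite sum of point masses and of images of Lebesgue measure on open intervals;
  the formula for sets extends to functions by the usual induction on measurable functions.\<close>

lemma nn_integral_graph_measure:
  assumes fin: "fin_digraph (gr \<Gamma>)" and f: "f \<in> borel_measurable (graph_measure \<Gamma> m \<rho>)"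
  shows "(\<integral>\<^sup>+x. f x \<partial>graph_measure \<Gamma> m \<rho>) =
     (\<Sum>p\<in>verts (gr \<Gamma>). ennreal (m p) * f (Vertex p)) +
     (\<Sum>e\<in>arcs (gr \<Gamma>). ennreal (\<rho> e) * (\<integral>\<^sup>+t. f (Inner e t) \<partial>open_edge \<Gamma> e))"
  using f
proof induction
  case (cong f g)
  have "(\<integral>\<^sup>+t. f (Inner e t) \<partial>open_edge \<Gamma> e) = (\<integral>\<^sup>+t. g (Inner e t) \<partial>open_edge \<Gamma> e)"
    if "e \<in> arcs (gr \<Gamma>)" for e
    using that cong(3) by (intro nn_integral_cong) (auto simp: points_def space_restrict_space)
  moreover have "f (Vertex p) = g (Vertex p)" if "p \<in> verts (gr \<Gamma>)" for p
    using that cong(3) by (auto simp: points_def)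
  moreover have "(\<integral>\<^sup>+x. f x \<partial>graph_measure \<Gamma> m \<rho>) = (\<integral>\<^sup>+x. g x \<partial>graph_measure \<Gamma> m \<rho>)"
    using cong(3) by (intro nn_integral_cong)
  ultimately show ?case using cong(4) by simp
next
  case (set A)
  have "(\<integral>\<^sup>+t. indicator A (Inner e t) \<partial>open_edge \<Gamma> e) =
        emeasure lborel {t. 0 < t \<and> t < len \<Gamma> e \<and> Inner e t \<in> A}" if "e \<in> arcs (gr \<Gamma>)" for e
  proof -
    have "(\<integral>\<^sup>+t. indicator A (Inner e t) \<partial>open_edge \<Gamma> e) =
      (\<integral>\<^sup>+t. indicator A (Inner e t) * indicator {0<..<len \<Gamma> e} t \<partial>lborel)"
      by (rule nn_integral_restrict_space) simp
    also have "\<dots> = (\<integral>\<^sup>+t. indicator {t. 0 < t \<and> t < len \<Gamma> e \<and> Inner e t \<in> A} t \<partial>lborel)"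
      by (intro nn_integral_cong) (auto split: split_indicator)
    also have "\<dots> = emeasure lborel {t. 0 < t \<and> t < len \<Gamma> e \<and> Inner e t \<in> A}"
      using set that by (intro nn_integral_indicator) (auto simp: borel_sets_def)
    finally show ?thesis .
  qed
  with set show ?case
    by (simp add: emeasure_graph_measure[OF fin] cong: sum.cong)
next
  case (mult u c)
  note [measurable] = mult(2)
  have "(\<integral>\<^sup>+t. c * u (Inner e t) \<partial>open_edge \<Gamma> e) = c * (\<integral>\<^sup>+t. u (Inner e t) \<partial>open_edge \<Gamma> e)"
    if "e \<in> arcs (gr \<Gamma>)" for e
    using that by (intro nn_integral_cmult) measurable
  then show ?case
    by (simp add: nn_integral_cmult mult.IH distrib_left sum_distrib_left mult.left_commute cong: sum.cong)
next
  case (add u v)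
  note [measurable] = add(1,3)
  have [measurable]: "u \<in> borel_measurable (graph_measure \<Gamma> m \<rho>)" "v \<in> borel_measurable (graph_measure \<Gamma> m \<rho>)"
    using add by auto
  have "(\<integral>\<^sup>+t. v (Inner e t) + u (Inner e t) \<partial>open_edge \<Gamma> e) =
      (\<integral>\<^sup>+t. v (Inner e t) \<partial>open_edge \<Gamma> e) + (\<integral>\<^sup>+t. u (Inner e t) \<partial>open_edge \<Gamma> e)"
    if "e \<in> arcs (gr \<Gamma>)" for e
    using that by (intro nn_integral_add) measurable
  then show ?case
    by (simp add: nn_integral_add add.IH distrib_left sum.distrib algebra_simps cong: sum.cong)
next
  case (seq U)
  note [measurable] = seq(1)
  have inc: "incseq (\<lambda>i. U i x)" for x
    using \<open>incseq U\<close> by (auto simp: incseq_def le_fun_def)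
  have edge: "(\<integral>\<^sup>+t. (SUP i. U i (Inner e t)) \<partial>open_edge \<Gamma> e) =
      (SUP i. \<integral>\<^sup>+t. U i (Inner e t) \<partial>open_edge \<Gamma> e)" if "e \<in> arcs (gr \<Gamma>)" for e
    using that inc by (intro nn_integral_monotone_convergence_SUP) (auto simp: incseq_def le_fun_def)
  have mono_edge: "incseq (\<lambda>i. \<integral>\<^sup>+t. U i (Inner e t) \<partial>open_edge \<Gamma> e)" for e
    using inc by (auto simp: incseq_def intro!: nn_integral_mono)
  have mono: "incseq (\<lambda>i. ennreal k * F i)" if "incseq F" for k and F :: "nat \<Rightarrow> ennreal"
    using that by (auto simp: incseq_def intro: mult_left_mono)
  have incseq_sum: "incseq (\<lambda>i. \<Sum>j\<in>J. F j i)" if "\<And>j. j \<in> J \<Longrightarrow> incseq (F j)"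
    for J :: "'c set" and F :: "'c \<Rightarrow> nat \<Rightarrow> ennreal"
    using that by (auto simp: incseq_def intro!: sum_mono)
  have "(\<integral>\<^sup>+x. (SUP i. U i x) \<partial>graph_measure \<Gamma> m \<rho>) = (SUP i. \<integral>\<^sup>+x. U i x \<partial>graph_measure \<Gamma> m \<rho>)"
    using seq by (intro nn_integral_monotone_convergence_SUP) auto
  also have "\<dots> = (SUP i. (\<Sum>p\<in>verts (gr \<Gamma>). ennreal (m p) * U i (Vertex p)) +
     (\<Sum>e\<in>arcs (gr \<Gamma>). ennreal (\<rho> e) * (\<integral>\<^sup>+t. U i (Inner e t) \<partial>open_edge \<Gamma> e)))"
    by (simp add: seq.IH)
  also have "\<dots> = (\<Sum>p\<in>verts (gr \<Gamma>). ennreal (m p) * (SUP i. U i (Vertex p))) +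
     (\<Sum>e\<in>arcs (gr \<Gamma>). ennreal (\<rho> e) * (SUP i. \<integral>\<^sup>+t. U i (Inner e t) \<partial>open_edge \<Gamma> e))"
    by (subst ennreal_SUP_add[OF incseq_sum incseq_sum])
       (auto simp: ennreal_SUP_sum mono inc mono_edge SUP_mult_left_ennreal)
  finally show ?case
    by (simp add: edge image_comp cong: sum.cong)
qed

lemma
  fixes f :: "('v, 'e) point \<Rightarrow> real"
  assumes fin: "fin_digraph (gr \<Gamma>)"
    and m: "\<And>p. p \<in> verts (gr \<Gamma>) \<Longrightarrow> 0 \<le> m p" and \<rho>: "\<And>e. e \<in> arcs (gr \<Gamma>) \<Longrightarrow> 0 \<le> \<rho> e"
    and f: "\<And>e. e \<in> arcs (gr \<Gamma>) \<Longrightarrow> integrable (open_edge \<Gamma> e) (\<lambda>t. f (Inner e t))"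
  shows integrable_graph_measure: "integrable (graph_measure \<Gamma> m \<rho>) f"
    and integral_graph_measure: "(\<integral>x. f x \<partial>graph_measure \<Gamma> m \<rho>) =
      (\<Sum>p\<in>verts (gr \<Gamma>). m p * f (Vertex p)) +
      (\<Sum>e\<in>arcs (gr \<Gamma>). \<rho> e * (\<integral>t. f (Inner e t) \<partial>open_edge \<Gamma> e))"
proof -
  have meas[measurable]: "f \<in> borel_measurable (graph_measure \<Gamma> m \<rho>)"
    using f by (intro measurable_graph_measure) auto
  have nn: "(\<integral>\<^sup>+x. ennreal (g (f x)) \<partial>graph_measure \<Gamma> m \<rho>) = ennreal (
      (\<Sum>p\<in>verts (gr \<Gamma>). m p * g (f (Vertex p))) +
      (\<Sum>e\<in>arcs (gr \<Gamma>). \<rho> e * (\<integral>t. g (f (Inner e t)) \<partial>open_edge \<Gamma> e)))"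
    if [measurable]: "g \<in> borel_measurable borel" and g: "\<And>x. 0 \<le> g x" "\<And>x. g x \<le> \<bar>x\<bar>"
    for g :: "real \<Rightarrow> real"
  proof -
    have edge: "integrable (open_edge \<Gamma> e) (\<lambda>t. g (f (Inner e t)))" if "e \<in> arcs (gr \<Gamma>)" for e
      using that f[OF that] g by (intro Bochner_Integration.integrable_bound[OF f[OF that]]) auto
    have "(\<integral>\<^sup>+t. ennreal (g (f (Inner e t))) \<partial>open_edge \<Gamma> e) =
        ennreal (\<integral>t. g (f (Inner e t)) \<partial>open_edge \<Gamma> e)" if "e \<in> arcs (gr \<Gamma>)" for e
      using edge[OF that] g by (intro nn_integral_eq_integral) auto
    then have "(\<integral>\<^sup>+x. ennreal (g (f x)) \<partial>graph_measure \<Gamma> m \<rho>) =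
      (\<Sum>p\<in>verts (gr \<Gamma>). ennreal (m p * g (f (Vertex p)))) +
      (\<Sum>e\<in>arcs (gr \<Gamma>). ennreal (\<rho> e * (\<integral>t. g (f (Inner e t)) \<partial>open_edge \<Gamma> e)))"
      using g m \<rho> by (subst nn_integral_graph_measure[OF fin]) (auto simp: ennreal_mult cong: sum.cong)
    also have "\<dots> = ennreal (\<Sum>p\<in>verts (gr \<Gamma>). m p * g (f (Vertex p))) +
      ennreal (\<Sum>e\<in>arcs (gr \<Gamma>). \<rho> e * (\<integral>t. g (f (Inner e t)) \<partial>open_edge \<Gamma> e))"
      using g m \<rho> by (intro arg_cong2[of _ _ _ _ "(+)"] sum_ennreal mult_nonneg_nonneg integral_nonneg) auto
    also have "\<dots> = ennreal ((\<Sum>p\<in>verts (gr \<Gamma>). m p * g (f (Vertex p))) +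
      (\<Sum>e\<in>arcs (gr \<Gamma>). \<rho> e * (\<integral>t. g (f (Inner e t)) \<partial>open_edge \<Gamma> e)))"
      using g m \<rho> by (intro ennreal_plus[symmetric] sum_nonneg mult_nonneg_nonneg integral_nonneg) auto
    finally show ?thesis .
  qed
  have max0: "enn2real (\<integral>\<^sup>+x. ennreal (k * f x) \<partial>graph_measure \<Gamma> m \<rho>) =
      (\<Sum>p\<in>verts (gr \<Gamma>). m p * max 0 (k * f (Vertex p))) +
      (\<Sum>e\<in>arcs (gr \<Gamma>). \<rho> e * (\<integral>t. max 0 (k * f (Inner e t)) \<partial>open_edge \<Gamma> e))"
    if "k = 1 \<or> k = -1" for k
  proof -
    have "ennreal (max 0 x) = ennreal x" for x
      by (simp add: max_def ennreal_neg)
    moreover have "(0::real) \<le> (\<Sum>p\<in>verts (gr \<Gamma>). m p * max 0 (k * f (Vertex p))) +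
      (\<Sum>e\<in>arcs (gr \<Gamma>). \<rho> e * (\<integral>t. max 0 (k * f (Inner e t)) \<partial>open_edge \<Gamma> e))"
      using m \<rho> by (intro add_nonneg_nonneg sum_nonneg mult_nonneg_nonneg integral_nonneg) auto
    ultimately show ?thesis
      using nn[of "\<lambda>x. max 0 (k * x)"] that by force
  qed
  show int: "integrable (graph_measure \<Gamma> m \<rho>) f"
    using nn[of abs] by (simp add: integrable_iff_bounded)
  have split: "max 0 x - max 0 (- x) = x" for x :: real
    by (simp add: max_def)
  have "(\<integral>t. f (Inner e t) \<partial>open_edge \<Gamma> e) =
      (\<integral>t. max 0 (f (Inner e t)) \<partial>open_edge \<Gamma> e) - (\<integral>t. max 0 (- f (Inner e t)) \<partial>open_edge \<Gamma> e)"
    if "e \<in> arcs (gr \<Gamma>)" for e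
    using f[OF that] by (subst Bochner_Integration.integral_diff[symmetric]) (auto simp: split)
  then have "(\<Sum>e\<in>arcs (gr \<Gamma>). \<rho> e * (\<integral>t. f (Inner e t) \<partial>open_edge \<Gamma> e)) =
      (\<Sum>e\<in>arcs (gr \<Gamma>). \<rho> e * (\<integral>t. max 0 (f (Inner e t)) \<partial>open_edge \<Gamma> e)) -
      (\<Sum>e\<in>arcs (gr \<Gamma>). \<rho> e * (\<integral>t. max 0 (- f (Inner e t)) \<partial>open_edge \<Gamma> e))"
    unfolding sum_subtractf[symmetric] right_diff_distrib[symmetric] by (intro sum.cong) auto
  moreover have "(\<Sum>p\<in>verts (gr \<Gamma>). m p * f (Vertex p)) =
      (\<Sum>p\<in>verts (gr \<Gamma>). m p * max 0 (f (Vertex p))) - (\<Sum>p\<in>verts (gr \<Gamma>). m p * max 0 (- f (Vertex p)))"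
    unfolding sum_subtractf[symmetric] right_diff_distrib[symmetric] split ..
  ultimately show "(\<integral>x. f x \<partial>graph_measure \<Gamma> m \<rho>) =
      (\<Sum>p\<in>verts (gr \<Gamma>). m p * f (Vertex p)) +
      (\<Sum>e\<in>arcs (gr \<Gamma>). \<rho> e * (\<integral>t. f (Inner e t) \<partial>open_edge \<Gamma> e))"
    unfolding real_lebesgue_integral_def[OF int] using max0[of 1] max0[of "-1"] by simp
qed

section \<open>Currents in a subdivided circuit\<close>

lemma finite_marks: "finite S \<Longrightarrow> finite (marks \<Gamma> S e)"
proof -
  assume "finite S"
  then have "finite (Inner e -` S)"
    by (rule finite_vimageI) (auto simp: inj_def)
  then show "finite (marks \<Gamma> S e)"
    by (auto simp: marks_def intro: finite_subset[of _ "Inner e -` S"])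
qed

definition next_mark :: "('v, 'e) metrized \<Rightarrow> ('v, 'e) point set \<Rightarrow> 'e \<Rightarrow> real \<Rightarrow> real" where
  "next_mark \<Gamma> S e s = Min {t \<in> marks \<Gamma> S e. s < t}"

definition prev_mark :: "('v, 'e) metrized \<Rightarrow> ('v, 'e) point set \<Rightarrow> 'e \<Rightarrow> real \<Rightarrow> real" where
  "prev_mark \<Gamma> S e t = Max {s \<in> marks \<Gamma> S e. s < t}"

text \<open>The marks of an edge are ordered, so a mark that is not the last one starts exactly one segment of
  the subdivided circuit and a mark that is not the first one ends exactly one. Hence the net current
  at a vertex needs only the initial and final slopes of the potential on the incident edges, and at
  an interior mark only the jump of the slope.\<close>

locale subdivided =
  fixes \<Gamma> :: "('v, 'e) metrized" and S :: "('v, 'e) point set"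
  assumes fin_gr: "fin_digraph (gr \<Gamma>)"
    and len_pos: "\<And>e. e \<in> arcs (gr \<Gamma>) \<Longrightarrow> 0 < len \<Gamma> e"
    and fin_S: "finite S" and S_points: "S \<subseteq> points \<Gamma>"
begin

abbreviation "G \<equiv> subdivision \<Gamma> S"

interpretation fin_digraph "gr \<Gamma>" by (rule fin_gr)

lemma mark_bounds: "e \<in> arcs (gr \<Gamma>) \<Longrightarrow> t \<in> marks \<Gamma> S e \<Longrightarrow> 0 \<le> t \<and> t \<le> len \<Gamma> e"
  using len_pos by (force simp: marks_def)

lemma arcs_subdivision_iff_next:
  assumes "e \<in> arcs (gr \<Gamma>)" "s \<in> marks \<Gamma> S e" "s < len \<Gamma> e"
  shows "(e, s, t) \<in> arcs G \<longleftrightarrow> t = next_mark \<Gamma> S e s"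
proof -
  have "finite {t \<in> marks \<Gamma> S e. s < t}"
    by (rule finite_subset[OF _ finite_marks[OF fin_S]]) blast
  moreover have "len \<Gamma> e \<in> {t \<in> marks \<Gamma> S e. s < t}"
    using assms(3) by (simp add: marks_def)
  ultimately have "t = next_mark \<Gamma> S e s \<longleftrightarrow> t \<in> {t \<in> marks \<Gamma> S e. s < t} \<and> (\<forall>u\<in>{t \<in> marks \<Gamma> S e. s < t}. t \<le> u)"
    unfolding next_mark_def by (subst eq_commute, intro Min_eq_iff) auto
  then show ?thesis
    using assms by (auto simp: subdivision_def not_less)
qed

lemma arcs_subdivision_iff_prev:
  assumes "e \<in> arcs (gr \<Gamma>)" "t \<in> marks \<Gamma> S e" "0 < t"
  shows "(e, s, t) \<in> arcs G \<longleftrightarrow> s = prev_mark \<Gamma> S e t"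
proof -
  have "finite {s \<in> marks \<Gamma> S e. s < t}"
    by (rule finite_subset[OF _ finite_marks[OF fin_S]]) blast
  moreover have "0 \<in> {s \<in> marks \<Gamma> S e. s < t}"
    using assms(3) by (simp add: marks_def)
  ultimately have "s = prev_mark \<Gamma> S e t \<longleftrightarrow> s \<in> {s \<in> marks \<Gamma> S e. s < t} \<and> (\<forall>u\<in>{s \<in> marks \<Gamma> S e. s < t}. u \<le> s)"
    unfolding prev_mark_def by (subst eq_commute, intro Max_eq_iff) auto
  then show ?thesis
    using assms by (auto simp: subdivision_def not_less)
qed

lemma arcs_subdivisionD:
  assumes "(e, s, t) \<in> arcs G"
  shows "e \<in> arcs (gr \<Gamma>)" "s \<in> marks \<Gamma> S e" "t \<in> marks \<Gamma> S e" "0 \<le> s" "s < t" "t \<le> len \<Gamma> e"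
    "u \<in> marks \<Gamma> S e \<Longrightarrow> u \<le> s \<or> t \<le> u"
proof -
  show 1: "e \<in> arcs (gr \<Gamma>)" "s \<in> marks \<Gamma> S e" "t \<in> marks \<Gamma> S e" "s < t"
    and "u \<in> marks \<Gamma> S e \<Longrightarrow> u \<le> s \<or> t \<le> u"
    using assms by (simp_all add: subdivision_def) (use not_less in blast)
  show "0 \<le> s" "t \<le> len \<Gamma> e"
    using mark_bounds[OF 1(1,2)] mark_bounds[OF 1(1,3)] by simp_all
qed

lemma edge_point_mark:
  assumes "e \<in> arcs (gr \<Gamma>)" "t \<in> marks \<Gamma> S e"
  shows "edge_point \<Gamma> e t \<in> verts G"
  using assms unfolding marks_def edge_point_def subdivision_def by simp blast

lemma tail_subdivision[simp]: "tail G (e, s, t) = edge_point \<Gamma> e s"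
  and head_subdivision[simp]: "head G (e, s, t) = edge_point \<Gamma> e t"
  by (simp_all add: subdivision_def)

lemma fin_subdivision: "fin_digraph G"
proof
  fix a assume "a \<in> arcs G"
  moreover obtain e s t where a: "a = (e, s, t)"
    by (cases a)
  ultimately have "e \<in> arcs (gr \<Gamma>)" "s \<in> marks \<Gamma> S e" "t \<in> marks \<Gamma> S e"
    using arcs_subdivisionD(1-3)[of e s t] by auto
  then show "tail G a \<in> verts G" "head G a \<in> verts G"
    by (simp_all add: a edge_point_mark)
next
  show "finite (verts G)"
    using fin_S by (simp add: subdivision_def)
  have "arcs G \<subseteq> (SIGMA e:arcs (gr \<Gamma>). marks \<Gamma> S e \<times> marks \<Gamma> S e)"
    by (auto simp: subdivision_def)
  then show "finite (arcs G)"
    by (rule finite_subset) (intro finite_SigmaI finite_arcs finite_marks fin_S)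
qed

text \<open>The two functions \<open>right\<close> and \<open>left\<close> give the one-sided slopes of \<open>h\<close> along an edge; agreement of
  \<open>right e s\<close> with \<open>left e t\<close> on every segment from \<open>s\<close> to \<open>t\<close> says that \<open>h\<close> is linear there.\<close>

lemma net_current_subdivision_Vertex:
  assumes slope: "\<And>e s t. (e, s, t) \<in> arcs G \<Longrightarrow>
      h (edge_point \<Gamma> e t) - h (edge_point \<Gamma> e s) = right e s * (t - s)"
    and slope': "\<And>e s t. (e, s, t) \<in> arcs G \<Longrightarrow> right e s = left e t"
  shows "net_current G (\<lambda>(e, s, t). t - s) h (Vertex p) =
     (\<Sum>e | e \<in> arcs (gr \<Gamma>) \<and> head (gr \<Gamma>) e = p. left e (len \<Gamma> e)) -
     (\<Sum>e | e \<in> arcs (gr \<Gamma>) \<and> tail (gr \<Gamma>) e = p. right e 0)"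
proof -
  have out: "{a \<in> arcs G. tail G a = Vertex p} =
      (\<lambda>e. (e, 0 :: real, next_mark \<Gamma> S e 0)) ` {e \<in> arcs (gr \<Gamma>). tail (gr \<Gamma>) e = p}"
  proof (intro equalityI subsetI)
    fix a assume "a \<in> {a \<in> arcs G. tail G a = Vertex p}"
    then obtain e s t where a: "a = (e, s, t)" "(e, s, t) \<in> arcs G" "edge_point \<Gamma> e s = Vertex p"
      by (cases a) auto
    from arcs_subdivisionD[OF a(2)] a(3) have "s = 0" "tail (gr \<Gamma>) e = p" "e \<in> arcs (gr \<Gamma>)"
      by (auto simp: edge_point_def split: if_splits)
    with a arcs_subdivision_iff_next[of e s t] arcs_subdivisionD[OF a(2)]
    show "a \<in> (\<lambda>e. (e, 0 :: real, next_mark \<Gamma> S e 0)) ` {e \<in> arcs (gr \<Gamma>). tail (gr \<Gamma>) e = p}"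
      by auto
  next
    fix a assume "a \<in> (\<lambda>e. (e, 0 :: real, next_mark \<Gamma> S e 0)) ` {e \<in> arcs (gr \<Gamma>). tail (gr \<Gamma>) e = p}"
    then show "a \<in> {a \<in> arcs G. tail G a = Vertex p}"
      using arcs_subdivision_iff_next[of _ 0] len_pos by (auto simp: edge_point_def marks_def)
  qed
  have inc: "{a \<in> arcs G. head G a = Vertex p} =
      (\<lambda>e. (e, prev_mark \<Gamma> S e (len \<Gamma> e), len \<Gamma> e)) ` {e \<in> arcs (gr \<Gamma>). head (gr \<Gamma>) e = p}"
  proof (intro equalityI subsetI)
    fix a assume "a \<in> {a \<in> arcs G. head G a = Vertex p}"
    then obtain e s t where a: "a = (e, s, t)" "(e, s, t) \<in> arcs G" "edge_point \<Gamma> e t = Vertex p"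
      by (cases a) auto
    from arcs_subdivisionD[OF a(2)] a(3) have "t = len \<Gamma> e" "head (gr \<Gamma>) e = p" "e \<in> arcs (gr \<Gamma>)"
      by (auto simp: edge_point_def split: if_splits)
    with a arcs_subdivision_iff_prev[of e t s] arcs_subdivisionD[OF a(2)]
    show "a \<in> (\<lambda>e. (e, prev_mark \<Gamma> S e (len \<Gamma> e), len \<Gamma> e)) ` {e \<in> arcs (gr \<Gamma>). head (gr \<Gamma>) e = p}"
      by auto
  next
    fix a assume "a \<in> (\<lambda>e. (e, prev_mark \<Gamma> S e (len \<Gamma> e), len \<Gamma> e)) ` {e \<in> arcs (gr \<Gamma>). head (gr \<Gamma>) e = p}"
    then obtain e where e: "a = (e, prev_mark \<Gamma> S e (len \<Gamma> e), len \<Gamma> e)" "e \<in> arcs (gr \<Gamma>)" "head (gr \<Gamma>) e = p"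
      by auto
    then show "a \<in> {a \<in> arcs G. head G a = Vertex p}"
      using arcs_subdivision_iff_prev[of e "len \<Gamma> e"] len_pos[of e] by (auto simp: edge_point_def marks_def)
  qed
  have o: "(\<Sum>a | a \<in> arcs G \<and> tail G a = Vertex p. (h (Vertex p) - h (head G a)) / (case a of (e, s, t) \<Rightarrow> t - s)) =
    (\<Sum>a\<in>{a \<in> arcs G. tail G a = Vertex p}. case a of (e, s, t) \<Rightarrow> - right e s)"
  proof (rule sum.cong)
    fix a assume "a \<in> {a \<in> arcs G. tail G a = Vertex p}"
    then show "(h (Vertex p) - h (head G a)) / (case a of (e, s, t) \<Rightarrow> t - s) = (case a of (e, s, t) \<Rightarrow> - right e s)"
      using slope[of "fst a" "fst (snd a)" "snd (snd a)"] arcs_subdivisionD(5)[of "fst a" "fst (snd a)" "snd (snd a)"]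
      by (cases a) (auto simp: field_simps)
  qed simp
  have i: "(\<Sum>a | a \<in> arcs G \<and> head G a = Vertex p. (h (Vertex p) - h (tail G a)) / (case a of (e, s, t) \<Rightarrow> t - s)) =
    (\<Sum>a\<in>{a \<in> arcs G. head G a = Vertex p}. case a of (e, s, t) \<Rightarrow> left e t)"
  proof (rule sum.cong)
    fix a assume "a \<in> {a \<in> arcs G. head G a = Vertex p}"
    then show "(h (Vertex p) - h (tail G a)) / (case a of (e, s, t) \<Rightarrow> t - s) = (case a of (e, s, t) \<Rightarrow> left e t)"
      using slope[of "fst a" "fst (snd a)" "snd (snd a)"] slope'[of "fst a" "fst (snd a)" "snd (snd a)"]
        arcs_subdivisionD(5)[of "fst a" "fst (snd a)" "snd (snd a)"]
      by (cases a) (auto simp: field_simps)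
  qed simp
  show ?thesis
    unfolding net_current_def o i unfolding out inc
    by (subst (1 2) sum.reindex) (auto simp: inj_on_def sum_negf)
qed

lemma net_current_subdivision_Inner:
  assumes slope: "\<And>e s t. (e, s, t) \<in> arcs G \<Longrightarrow>
      h (edge_point \<Gamma> e t) - h (edge_point \<Gamma> e s) = right e s * (t - s)"
    and slope': "\<And>e s t. (e, s, t) \<in> arcs G \<Longrightarrow> right e s = left e t"
    and x: "Inner e t \<in> S"
  shows "net_current G (\<lambda>(e, s, t). t - s) h (Inner e t) = left e t - right e t"
proof -
  have e: "e \<in> arcs (gr \<Gamma>)" "0 < t" "t < len \<Gamma> e"
    using x S_points by (auto simp: points_def)
  have t: "t \<in> marks \<Gamma> S e"
    using x e by (simp add: marks_def)
  have ep: "edge_point \<Gamma> e' t' = Inner e t \<longleftrightarrow> e' = e \<and> t' = t" for e' t'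
    using e by (auto simp: edge_point_def)
  define u v where "u = next_mark \<Gamma> S e t" and "v = prev_mark \<Gamma> S e t"
  note nxt = arcs_subdivision_iff_next[OF e(1) t e(3), folded u_def]
  note prv = arcs_subdivision_iff_prev[OF e(1) t e(2), folded v_def]
  have out: "{a \<in> arcs G. tail G a = Inner e t} = {(e, t, u)}"
  proof (intro equalityI subsetI)
    fix a assume a: "a \<in> {a \<in> arcs G. tail G a = Inner e t}"
    obtain e' s' t' where "a = (e', s', t')" by (cases a)
    with a nxt[of t'] show "a \<in> {(e, t, u)}"
      by (clarsimp simp: ep)
  qed (use nxt[of u] ep[of e t] in simp)
  have inc: "{a \<in> arcs G. head G a = Inner e t} = {(e, v, t)}"
  proof (intro equalityI subsetI)
    fix a assume a: "a \<in> {a \<in> arcs G. head G a = Inner e t}"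
    obtain e' s' t' where "a = (e', s', t')" by (cases a)
    with a prv[of s'] show "a \<in> {(e, v, t)}"
      by (clarsimp simp: ep)
  qed (use prv[of v] ep[of e t] in simp)
  have arcs: "(e, t, u) \<in> arcs G" "(e, v, t) \<in> arcs G"
    using nxt[of u] prv[of v] by simp_all
  have "edge_point \<Gamma> e t = Inner e t"
    using ep by simp
  then have "(h (Inner e t) - h (edge_point \<Gamma> e u)) / (u - t) = - right e t"
    and "(h (Inner e t) - h (edge_point \<Gamma> e v)) / (t - v) = left e t"
    using slope[OF arcs(1)] slope[OF arcs(2)] slope'[OF arcs(2)]
      arcs_subdivisionD(5)[OF arcs(1)] arcs_subdivisionD(5)[OF arcs(2)]
    by (simp_all add: field_simps)
  then show ?thesis
    unfolding net_current_def out inc by simp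
qed

end

section \<open>The resistance function from the resistances between vertices\<close>

lemma net_current_linear:
  "net_current G R (\<lambda>v. k * h v + l * h' v) p = k * net_current G R h p + l * net_current G R h' p"
proof -
  have "((k * x + l * x') - (k * y + l * y')) / z = k * ((x - y) / z) + l * ((x' - y') / z)" for x x' y y' z :: real
    by (simp add: divide_inverse algebra_simps)
  then show ?thesis
    unfolding net_current_def distrib_left sum_distrib_left by (simp add: sum.distrib)
qed

text \<open>The hypothesis \<open>net_r\<close> characterises the effective resistances between vertices: half the difference
  of \<open>r\<close> with poles \<open>q\<close> and \<open>p\<close> is a potential for the unit current from \<open>p\<close> to \<open>q\<close>. The current \<open>c\<close>
  that does not depend on the pole is, up to a factor \<open>2\<close>, the canonical measure pushed to the vertices
  by linear interpolation along the edges.\<close>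

locale resistance_kernel =
  fixes \<Gamma> :: "('v, 'e) metrized" and r :: "'v \<Rightarrow> 'v \<Rightarrow> real" and c :: "'v \<Rightarrow> real"
  assumes fin_gr: "fin_digraph (gr \<Gamma>)"
    and len_pos: "\<And>e. e \<in> arcs (gr \<Gamma>) \<Longrightarrow> 0 < len \<Gamma> e"
    and r_sym: "\<And>p q. p \<in> verts (gr \<Gamma>) \<Longrightarrow> q \<in> verts (gr \<Gamma>) \<Longrightarrow> r p q = r q p"
    and r_diag: "\<And>p. p \<in> verts (gr \<Gamma>) \<Longrightarrow> r p p = 0"
    and net_r: "\<And>p z. p \<in> verts (gr \<Gamma>) \<Longrightarrow> z \<in> verts (gr \<Gamma>) \<Longrightarrow>
       net_current (gr \<Gamma>) (len \<Gamma>) (\<lambda>v. r v z) p = c p - 2 * of_bool (p = z)"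
begin

sublocale fin_digraph "gr \<Gamma>" by (rule fin_gr)

definition interp :: "('v \<Rightarrow> real) \<Rightarrow> ('v, 'e) point \<Rightarrow> real" where
  "interp \<phi> x = (case x of Vertex p \<Rightarrow> \<phi> p
     | Inner e t \<Rightarrow> (1 - t / len \<Gamma> e) * \<phi> (tail (gr \<Gamma>) e) + t / len \<Gamma> e * \<phi> (head (gr \<Gamma>) e))"

lemma interp_simps[simp]:
  "interp \<phi> (Vertex p) = \<phi> p"
  "interp \<phi> (Inner e t) = (1 - t / len \<Gamma> e) * \<phi> (tail (gr \<Gamma>) e) + t / len \<Gamma> e * \<phi> (head (gr \<Gamma>) e)"
  by (simp_all add: interp_def)

text \<open>The reciprocal of the length of the edge plus the effective resistance between its end points in the
  rest of the graph, see \<open>deleted_resistance_eq\<close>; it vanishes on a bridge.\<close>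

definition density :: "'e \<Rightarrow> real" where
  "density e = (1 - r (tail (gr \<Gamma>) e) (head (gr \<Gamma>) e) / len \<Gamma> e) / len \<Gamma> e"

definition bump :: "('v, 'e) point \<Rightarrow> real" where
  "bump x = (case x of Vertex p \<Rightarrow> 0 | Inner e t \<Rightarrow> density e * t * (len \<Gamma> e - t))"

text \<open>The Green function of the segment with both end points grounded; it carries the kink that the
  resistance function has when both points lie on the same edge.\<close>

definition green :: "'e \<Rightarrow> real \<Rightarrow> ('v, 'e) point \<Rightarrow> real" where
  "green e t y = (case y of Vertex p \<Rightarrow> 0
     | Inner e' w \<Rightarrow> if e' = e then min t w - t * w / len \<Gamma> e else 0)"

definition profile :: "('v, 'e) point \<Rightarrow> 'v \<Rightarrow> real" where
  "profile y v = interp (r v) y"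

text \<open>On each edge the resistance function of a pole \<open>y\<close> has the same second derivative \<open>- 2 * density e\<close>
  away from \<open>y\<close>, so it is the linear interpolation of its values at the two end points plus a fixed parabola
  vanishing there, corrected by the Green function on the edge of \<open>y\<close>.\<close>

definition kernel :: "('v, 'e) point \<Rightarrow> ('v, 'e) point \<Rightarrow> real" where
  "kernel x y = interp (profile y) x + bump x + bump y -
     2 * (case x of Vertex p \<Rightarrow> 0 | Inner e t \<Rightarrow> green e t y)"

lemma kernel_edge_point:
  assumes e: "e \<in> arcs (gr \<Gamma>)" and t: "0 \<le> t" "t \<le> len \<Gamma> e" and y: "y \<in> points \<Gamma>"
  shows "kernel (edge_point \<Gamma> e t) y = (1 - t / len \<Gamma> e) * profile y (tail (gr \<Gamma>) e) +
     t / len \<Gamma> e * profile y (head (gr \<Gamma>) e) + density e * t * (len \<Gamma> e - t) + bump y - 2 * green e t y"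
  using len_pos[OF e] t y
  by (cases y) (auto simp: kernel_def edge_point_def bump_def green_def points_def)

lemma kernel_self: 
  assumes "x \<in> points \<Gamma>"
  shows "kernel x x = 0"
proof (cases x)
  case (Vertex p)
  with assms have "p \<in> verts (gr \<Gamma>)" by (auto simp: points_def)
  with Vertex show ?thesis by (simp add: kernel_def profile_def bump_def r_diag)
next
  case (Inner e t)
  with assms have e: "e \<in> arcs (gr \<Gamma>)" by (auto simp: points_def)
  with Inner len_pos[OF e] r_sym[of "head (gr \<Gamma>) e" "tail (gr \<Gamma>) e"] show ?thesis 
    by (simp add: kernel_def profile_def bump_def green_def density_def r_diag field_simps)
qed

lemma interp_profile_sym:
  assumes "x \<in> points \<Gamma>" "y \<in> points \<Gamma>"
  shows "interp (profile y) x = interp (profile x) y"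
proof -
  have v: "tail (gr \<Gamma>) e \<in> verts (gr \<Gamma>)" "head (gr \<Gamma>) e \<in> verts (gr \<Gamma>)" if "Inner e t \<in> points \<Gamma>" for e t
    using that by (auto simp: points_def)
  have "p \<in> verts (gr \<Gamma>)" if "Vertex p \<in> points \<Gamma>" for p
    using that by (auto simp: points_def)
  with assms v r_sym show ?thesis
    by (cases x; cases y) (simp_all add: profile_def distrib_left mult.left_commute)
qed

lemma kernel_sym:
  assumes "x \<in> points \<Gamma>" "y \<in> points \<Gamma>"
  shows "kernel x y = kernel y x"
  using interp_profile_sym[OF assms]
  by (cases x; cases y) (simp_all add: kernel_def green_def min.commute mult.commute)

text \<open>Barycentric coordinates of a point with respect to the vertices.\<close>

definition weight :: "('v, 'e) point \<Rightarrow> 'v \<Rightarrow> real" where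
  "weight y p = interp (\<lambda>v. of_bool (v = p)) y"

lemma net_profile:
  assumes p: "p \<in> verts (gr \<Gamma>)" and y: "y \<in> points \<Gamma>"
  shows "net_current (gr \<Gamma>) (len \<Gamma>) (profile y) p = c p - 2 * weight y p"
proof (cases y)
  case (Vertex q)
  then have "q \<in> verts (gr \<Gamma>)" using y by (auto simp: points_def)
  moreover have "profile y = (\<lambda>v. r v q)"
    by (simp add: Vertex profile_def fun_eq_iff)
  ultimately show ?thesis
    using net_r[OF p, of q] Vertex by (auto simp: weight_def)
next
  case (Inner e t)
  then have e: "tail (gr \<Gamma>) e \<in> verts (gr \<Gamma>)" "head (gr \<Gamma>) e \<in> verts (gr \<Gamma>)" 
    using y by (auto simp: points_def)
  have "net_current (gr \<Gamma>) (len \<Gamma>) (profile y) p = 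
     (1 - t / len \<Gamma> e) * (c p - 2 * of_bool (p = tail (gr \<Gamma>) e)) + t / len \<Gamma> e * (c p - 2 * of_bool (p = head (gr \<Gamma>) e))"
    unfolding profile_def Inner interp_simps net_current_linear using p e by (simp add: net_r)
  also have "\<dots> = c p - 2 * weight y p"
    unfolding Inner weight_def interp_simps by (simp add: eq_commute[of p] algebra_simps)
  finally show ?thesis .
qed

text \<open>One-sided slopes of \<open>green\<close> in its second argument; at the kink the comparison has to be strict on one
  side only.\<close>

definition green_right :: "'e \<Rightarrow> real \<Rightarrow> ('v, 'e) point \<Rightarrow> real" where
  "green_right e s y = (case y of Vertex p \<Rightarrow> 0
     | Inner e' w \<Rightarrow> if e' = e then of_bool (s < w) - w / len \<Gamma> e else 0)"

definition green_left :: "'e \<Rightarrow> real \<Rightarrow> ('v, 'e) point \<Rightarrow> real" where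
  "green_left e s y = (case y of Vertex p \<Rightarrow> 0
     | Inner e' w \<Rightarrow> if e' = e then of_bool (s \<le> w) - w / len \<Gamma> e else 0)"

lemma green_jump: 
  "e \<in> arcs (gr \<Gamma>) \<Longrightarrow> green_left e t y - green_right e t y = of_bool (y = Inner e t)"
  by (cases y) (auto simp: green_right_def green_left_def)

text \<open>A unit current fed into an interior point of a grounded segment leaves through the two ends in
  proportion to the barycentric coordinates.\<close>

lemma green_vertex:
  assumes p: "p \<in> verts (gr \<Gamma>)" and y: "y \<in> points \<Gamma>"
  shows "(\<Sum>e | e \<in> arcs (gr \<Gamma>) \<and> tail (gr \<Gamma>) e = p. green_right e 0 y) - 
    (\<Sum>e | e \<in> arcs (gr \<Gamma>) \<and> head (gr \<Gamma>) e = p. green_left e (len \<Gamma> e) y) = weight y p - of_bool (y = Vertex p)"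
proof (cases y)
  case (Vertex q)
  then show ?thesis by (simp add: green_right_def green_left_def weight_def)
next
  case (Inner e' w)
  then have e': "e' \<in> arcs (gr \<Gamma>)" "0 < w" "w < len \<Gamma> e'" 
    using y by (auto simp: points_def)
  have "(\<Sum>e | e \<in> arcs (gr \<Gamma>) \<and> tail (gr \<Gamma>) e = p. green_right e 0 y) =
    (\<Sum>e | e \<in> arcs (gr \<Gamma>) \<and> tail (gr \<Gamma>) e = p. if e' = e then 1 - w / len \<Gamma> e' else 0)"
    using e' by (intro sum.cong) (auto simp: Inner green_right_def)
  also have "\<dots> = (1 - w / len \<Gamma> e') * of_bool (tail (gr \<Gamma>) e' = p)"
    using e' by (subst sum.delta') auto
  moreover have "(\<Sum>e | e \<in> arcs (gr \<Gamma>) \<and> head (gr \<Gamma>) e = p. green_left e (len \<Gamma> e) y) =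
    (\<Sum>e | e \<in> arcs (gr \<Gamma>) \<and> head (gr \<Gamma>) e = p. if e' = e then - w / len \<Gamma> e' else 0)"
    using e' by (intro sum.cong) (auto simp: Inner green_left_def)
  moreover have "\<dots> = (- w / len \<Gamma> e') * of_bool (head (gr \<Gamma>) e' = p)"
    using e' by (subst sum.delta') auto
  ultimately show ?thesis
    by (simp add: Inner weight_def)
qed

lemma green_slope:
  assumes "e \<in> arcs (gr \<Gamma>)" "s < t" and "\<And>w. y = Inner e w \<Longrightarrow> w \<le> s \<or> t \<le> w"
  shows "green e t y - green e s y = green_right e s y * (t - s)" "green_right e s y = green_left e t y"
  using assms len_pos[OF assms(1)]
  by (cases y; force simp: green_def green_right_def green_left_def field_simps min_def)+

text \<open>Half the difference of the kernels with poles \<open>y\<close> and \<open>x\<close> is the potential of the unit current from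
  \<open>x\<close> to \<open>y\<close>: the parabolas cancel, so it is linear on every segment of the subdivision, and the only
  jumps of its slope come from the Green functions.\<close>

theorem resistance_eq_kernel:
  assumes x: "x \<in> points \<Gamma>" and y: "y \<in> points \<Gamma>"
  shows "resistance \<Gamma> x y = kernel x y"
proof -
  interpret subdivided \<Gamma> "{x, y}"
    using fin_gr len_pos x y by unfold_locales auto
  \<comment> \<open>Normalised so that the difference of its values at \<open>x\<close> and \<open>y\<close> is \<open>kernel x y\<close>.\<close>
  define h where "h z = 1 / 2 * kernel z y + (- 1 / 2) * kernel z x" for z
  define \<psi> where "\<psi> v = 1 / 2 * profile y v + (- 1 / 2) * profile x v" for v
  define sl where "sl e = (\<psi> (head (gr \<Gamma>) e) - \<psi> (tail (gr \<Gamma>) e)) / len \<Gamma> e" for e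
  define right where "right e s = sl e - green_right e s y + green_right e s x" for e s
  define left where "left e s = sl e - green_left e s y + green_left e s x" for e s
  have slope: "h (edge_point \<Gamma> e t) - h (edge_point \<Gamma> e s) = right e s * (t - s) \<and> right e s = left e t"
    if a: "(e, s, t) \<in> arcs G" for e s t
  proof -
    note a = arcs_subdivisionD[OF a]
    have mark: "w \<le> s \<or> t \<le> w" if "z = Inner e w" "z \<in> {x, y}" for z w
      using a(7)[of w] that x y by (auto simp: marks_def points_def)
    have gy: "green e t y = green e s y + green_right e s y * (t - s)" "green_right e s y = green_left e t y"
      using green_slope[OF a(1,5), of y] mark[of y] by auto
    have gx: "green e t x = green e s x + green_right e s x * (t - s)" "green_right e s x = green_left e t x"
      using green_slope[OF a(1,5), of x] mark[of x] by auto
    have "h (edge_point \<Gamma> e u) = \<psi> (tail (gr \<Gamma>) e) + u * sl e + (bump y - bump x) / 2 - green e u y + green e u x"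
      if "0 \<le> u" "u \<le> len \<Gamma> e" for u
      using that a(1) len_pos[OF a(1)]
      by (simp add: h_def \<psi>_def sl_def kernel_edge_point x y field_simps)
    from this[of s] this[of t] a(4-6) gx gy show ?thesis
      by (simp add: right_def left_def algebra_simps)
  qed
  have vert: "net_current G (\<lambda>(e, s, t). t - s) h (Vertex p) = of_bool (Vertex p = x) - of_bool (Vertex p = y)"
    if p: "p \<in> verts (gr \<Gamma>)" for p
  proof -
    have "net_current G (\<lambda>(e, s, t). t - s) h (Vertex p) =
     (\<Sum>e | e \<in> arcs (gr \<Gamma>) \<and> head (gr \<Gamma>) e = p. left e (len \<Gamma> e)) -
     (\<Sum>e | e \<in> arcs (gr \<Gamma>) \<and> tail (gr \<Gamma>) e = p. right e 0)"
      using slope by (intro net_current_subdivision_Vertex) auto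
    also have "\<dots> = net_current (gr \<Gamma>) (len \<Gamma>) \<psi> p + (weight y p - of_bool (y = Vertex p)) - (weight x p - of_bool (x = Vertex p))"
      unfolding green_vertex[OF p y, symmetric] green_vertex[OF p x, symmetric] net_current_def
      by (simp add: left_def right_def sl_def sum.distrib sum_subtractf diff_divide_distrib)
    also have "net_current (gr \<Gamma>) (len \<Gamma>) \<psi> p = weight x p - weight y p"
      unfolding \<psi>_def net_current_linear using p x y by (simp add: net_profile diff_divide_distrib)
    finally show ?thesis by (simp add: eq_commute)
  qed
  have inner: "net_current G (\<lambda>(e, s, t). t - s) h (Inner e t) = of_bool (Inner e t = x) - of_bool (Inner e t = y)"
    if "Inner e t \<in> {x, y}" for e t
  proof -
    have e: "e \<in> arcs (gr \<Gamma>)" using that x y by (auto simp: points_def)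
    have "net_current G (\<lambda>(e, s, t). t - s) h (Inner e t) = left e t - right e t"
      using slope that by (intro net_current_subdivision_Inner) auto
    also have "\<dots> = of_bool (x = Inner e t) - of_bool (y = Inner e t)"
      using green_jump[OF e, of t x] green_jump[OF e, of t y] by (simp add: left_def right_def)
    finally show ?thesis by (simp add: eq_commute)
  qed
  have "unit_potential G (\<lambda>(e, s, t). t - s) x y h"
    unfolding unit_potential_def
  proof
    fix v assume "v \<in> verts G"
    then show "net_current G (\<lambda>(e, s, t). t - s) h v = of_bool (v = x) - of_bool (v = y)"
      using vert inner x y by (cases v) (auto simp: subdivision_def points_def)
  qed
  moreover have "x \<in> verts G" "y \<in> verts G" by (simp_all add: subdivision_def)
  ultimately have "eff_resistance G (\<lambda>(e, s, t). t - s) x y = ereal (h x - h y)"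
    using fin_subdivision by (intro eff_resistance_eq) auto
  then show ?thesis
    using kernel_self[OF x] kernel_self[OF y] kernel_sym[OF x y] by (simp add: resistance_def h_def)
qed

text \<open>When a unit current flows between the end points of \<open>e\<close>, the fraction \<open>len \<Gamma> e * density e\<close> avoids
  \<open>e\<close>. Rescaling the potential by this fraction gives the unit current in the graph without \<open>e\<close>.\<close>

lemma deleted_resistance_eq:
  assumes e: "e \<in> arcs (gr \<Gamma>)" and pos: "density e \<noteq> 0"
  shows "deleted_resistance \<Gamma> e = ereal (1 / density e - len \<Gamma> e)"
proof -
  define p q where "p = tail (gr \<Gamma>) e" and "q = head (gr \<Gamma>) e"
  have pq: "p \<in> verts (gr \<Gamma>)" "q \<in> verts (gr \<Gamma>)" using e by (auto simp: p_def q_def)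
  \<comment> \<open>The factor \<open>1 / 2\<close> normalises the current in the whole graph, the rest compensates the current through \<open>e\<close>.\<close>
  define k where "k = 1 / (2 * len \<Gamma> e * density e)"
  define h where "h v = k * r v q + (- k) * r v p" for v
  let ?H = "del_arc e"
  have net: "net_current (gr \<Gamma>) (len \<Gamma>) h v = 2 * k * (of_bool (v = p) - of_bool (v = q))" if "v \<in> verts (gr \<Gamma>)" for v
    unfolding h_def net_current_linear using that pq by (simp add: net_r algebra_simps)
  have hpq: "h p - h q = 2 * k * r p q"
    using pq r_sym[of p q] r_diag by (simp add: h_def)
  have out: "(\<Sum>a | a \<in> arcs ?H \<and> tail ?H a = v. F a) = 
     (\<Sum>a | a \<in> arcs (gr \<Gamma>) \<and> tail (gr \<Gamma>) a = v. F a) - of_bool (v = p) * F e" for v and F :: "'e \<Rightarrow> real"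
  proof (cases "v = p")
    case True
    then have "{a. a \<in> arcs ?H \<and> tail ?H a = v} = {a. a \<in> arcs (gr \<Gamma>) \<and> tail (gr \<Gamma>) a = v} - {e}" by auto
    with True e show ?thesis by (simp add: sum_diff1 p_def)
  next
    case False
    then have "{a. a \<in> arcs ?H \<and> tail ?H a = v} = {a. a \<in> arcs (gr \<Gamma>) \<and> tail (gr \<Gamma>) a = v}" by (auto simp: p_def)
    with False show ?thesis by simp
  qed
  have inc: "(\<Sum>a | a \<in> arcs ?H \<and> head ?H a = v. F a) = 
     (\<Sum>a | a \<in> arcs (gr \<Gamma>) \<and> head (gr \<Gamma>) a = v. F a) - of_bool (v = q) * F e" for v and F :: "'e \<Rightarrow> real"
  proof (cases "v = q")
    case True
    then have "{a. a \<in> arcs ?H \<and> head ?H a = v} = {a. a \<in> arcs (gr \<Gamma>) \<and> head (gr \<Gamma>) a = v} - {e}" by auto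
    with True e show ?thesis by (simp add: sum_diff1 q_def)
  next
    case False
    then have "{a. a \<in> arcs ?H \<and> head ?H a = v} = {a. a \<in> arcs (gr \<Gamma>) \<and> head (gr \<Gamma>) a = v}" by (auto simp: q_def)
    with False show ?thesis by simp
  qed
  have unit: "2 * k - (h p - h q) / len \<Gamma> e = 1"
  proof -
    have "1 - r p q / len \<Gamma> e = density e * len \<Gamma> e"
      using len_pos[OF e] by (simp add: density_def p_def q_def)
    moreover have "2 * k - 2 * k * r p q / len \<Gamma> e = 2 * k * (1 - r p q / len \<Gamma> e)"
      by (simp add: right_diff_distrib)
    ultimately show ?thesis
      using pos len_pos[OF e] unfolding hpq by (simp add: k_def)
  qed
  have "unit_potential ?H (len \<Gamma>) p q h"
    unfolding unit_potential_def
  proof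
    fix v assume "v \<in> verts ?H"
    then have v: "v \<in> verts (gr \<Gamma>)" by simp
    have "net_current ?H (len \<Gamma>) h v = net_current (gr \<Gamma>) (len \<Gamma>) h v - 
      of_bool (v = p) * ((h v - h q) / len \<Gamma> e) - of_bool (v = q) * ((h v - h p) / len \<Gamma> e)"
      unfolding net_current_def out inc by (simp add: p_def q_def)
    also have "\<dots> = (2 * k - (h p - h q) / len \<Gamma> e) * (of_bool (v = p) - of_bool (v = q))"
      unfolding net[OF v] by (auto simp: algebra_simps diff_divide_distrib)
    finally show "net_current ?H (len \<Gamma>) h v = of_bool (v = p) - of_bool (v = q)"
      unfolding unit by simp
  qed
  then have "eff_resistance ?H (len \<Gamma>) p q = ereal (h p - h q)"
    using pq by (intro eff_resistance_eq fin_digraph_del_arc) auto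
  moreover have "h p - h q = 1 / density e - len \<Gamma> e"
    using unit pos len_pos[OF e] by (simp add: k_def field_simps)
  ultimately show ?thesis
    by (simp add: deleted_resistance_def p_def q_def)
qed

end

section \<open>Integrals along an edge\<close>

text \<open>The integrand may take any value at the break point \<open>w\<close>, because the derivative of the resistance
  function does not exist at its pole.\<close>

lemma has_bochner_integral_piecewise:
  fixes f f1 f2 F1 F2 :: "real \<Rightarrow> real"
  assumes w: "0 \<le> w" "w \<le> l"
    and F: "\<And>t. (F1 has_real_derivative f1 t) (at t)" "\<And>t. (F2 has_real_derivative f2 t) (at t)"
    and cont: "\<And>t. isCont f1 t" "\<And>t. isCont f2 t"
    and f: "\<And>t. 0 < t \<Longrightarrow> t < w \<Longrightarrow> f t = f1 t" "\<And>t. w < t \<Longrightarrow> t < l \<Longrightarrow> f t = f2 t"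
  shows "has_bochner_integral (restrict_space lborel {0<..<l}) f (F1 w - F1 0 + (F2 l - F2 w))"
proof -
  have [measurable]: "f1 \<in> borel_measurable borel" "f2 \<in> borel_measurable borel"
    using cont by (auto intro!: borel_measurable_continuous_onI simp: continuous_on_eq_continuous_at)
  have "has_bochner_integral lborel (\<lambda>t. f1 t * indicator {0..w} t) (F1 w - F1 0)"
    using w F cont by (intro has_bochner_integral_FTC_Icc_real) auto
  moreover have "has_bochner_integral lborel (\<lambda>t. f2 t * indicator {w..l} t) (F2 l - F2 w)"
    using w F cont by (intro has_bochner_integral_FTC_Icc_real) auto
  ultimately have sum: "has_bochner_integral lborel (\<lambda>t. f1 t * indicator {0..w} t + f2 t * indicator {w..l} t)
      (F1 w - F1 0 + (F2 l - F2 w))"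
    by (rule has_bochner_integral_add)
  have "(\<lambda>t. indicator {0<..<l} t *\<^sub>R f t) =
      (\<lambda>t. if t = w then indicator {0<..<l} w * f w
           else if 0 < t \<and> t < w then f1 t else if w < t \<and> t < l then f2 t else 0)"
    using w f by (auto simp: fun_eq_iff indicator_def)
  then have meas: "(\<lambda>t. indicator {0<..<l} t *\<^sub>R f t) \<in> borel_measurable lborel"
    by simp
  have "AE t in lborel. f1 t * indicator {0..w} t + f2 t * indicator {w..l} t = indicator {0<..<l} t *\<^sub>R f t"
    using AE_lborel_singleton[of 0] AE_lborel_singleton[of w] AE_lborel_singleton[of l]
    by eventually_elim (use w f in \<open>auto simp: indicator_def\<close>)
  then have "has_bochner_integral lborel (\<lambda>t. indicator {0<..<l} t *\<^sub>R f t) (F1 w - F1 0 + (F2 l - F2 w))"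
    using sum by (subst (asm) has_bochner_integral_cong_AE[OF _ meas]) measurable
  then show ?thesis
    by (subst has_bochner_integral_restrict_space) auto
qed

context resistance_kernel
begin

text \<open>If \<open>y\<close> is not an interior point of \<open>e\<close>, the value \<open>0\<close> makes the Green function of the segment vanish,
  so that one formula describes the resistance function on all edges.\<close>

definition slot :: "'e \<Rightarrow> ('v, 'e) point \<Rightarrow> real" where
  "slot e y = (case y of Vertex p \<Rightarrow> 0 | Inner e' w \<Rightarrow> if e' = e then w else 0)"

lemma slot_bounds:
  assumes "e \<in> arcs (gr \<Gamma>)" "y \<in> points \<Gamma>"
  shows "0 \<le> slot e y" "slot e y \<le> len \<Gamma> e"
  using assms len_pos[OF assms(1)] by (auto simp: slot_def points_def split: point.splits)

lemma sum_slot: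
  assumes "y \<in> points \<Gamma>" and "\<And>e. F e 0 = 0"
  shows "(\<Sum>e\<in>arcs (gr \<Gamma>). F e (slot e y)) = (case y of Vertex p \<Rightarrow> 0 | Inner e w \<Rightarrow> (F e w :: real))"
proof (cases y)
  case (Vertex p)
  then show ?thesis by (simp add: slot_def assms(2))
next
  case (Inner e w)
  then have e: "e \<in> arcs (gr \<Gamma>)" using assms(1) by (auto simp: points_def)
  have "(\<Sum>a\<in>arcs (gr \<Gamma>). F a (slot a y)) = (\<Sum>a\<in>arcs (gr \<Gamma>). if e = a then F e w else 0)"
    by (intro sum.cong) (auto simp: slot_def Inner assms(2))
  then show ?thesis using e by (simp add: Inner)
qed

lemma resistance_Inner:
  assumes e: "e \<in> arcs (gr \<Gamma>)" and t: "0 < t" "t < len \<Gamma> e" and y: "y \<in> points \<Gamma>"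
  shows "resistance \<Gamma> (Inner e t) y = (1 - t / len \<Gamma> e) * profile y (tail (gr \<Gamma>) e) +
     t / len \<Gamma> e * profile y (head (gr \<Gamma>) e) + density e * t * (len \<Gamma> e - t) + bump y
     - 2 * (min t (slot e y) - t * slot e y / len \<Gamma> e)"
proof -
  have "Inner e t \<in> points \<Gamma>"
    using e t by (auto simp: points_def)
  moreover have "green e t y = min t (slot e y) - t * slot e y / len \<Gamma> e"
    using t by (simp add: green_def slot_def split: point.split)
  ultimately show ?thesis
    using kernel_edge_point[OF e _ _ y, of t] t by (simp add: resistance_eq_kernel y edge_point_def)
qed

lemma has_bochner_integral_resistance:
  assumes e: "e \<in> arcs (gr \<Gamma>)" and y: "y \<in> points \<Gamma>"
  shows "has_bochner_integral (open_edge \<Gamma> e) (\<lambda>t. resistance \<Gamma> (Inner e t) y)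
     ((profile y (tail (gr \<Gamma>) e) + profile y (head (gr \<Gamma>) e)) * len \<Gamma> e / 2 + density e * len \<Gamma> e ^ 3 / 6
      + bump y * len \<Gamma> e - slot e y * (len \<Gamma> e - slot e y))"
proof -
  define l w a b m z where "l = len \<Gamma> e" and "w = slot e y" and "a = profile y (tail (gr \<Gamma>) e)"
    and "b = profile y (head (gr \<Gamma>) e)" and "m = density e" and "z = bump y"
  note defs = l_def[symmetric] w_def[symmetric] a_def[symmetric] b_def[symmetric] m_def[symmetric] z_def[symmetric]
  have l: "0 < l" using len_pos[OF e] by (simp add: l_def)
  have w: "0 \<le> w" "w \<le> l" using slot_bounds[OF e y] by (simp_all add: l_def w_def)
  define F1 where "F1 t = a * (t - t\<^sup>2 / (2 * l)) + b * t\<^sup>2 / (2 * l) + m * (t\<^sup>2 * l / 2 - t ^ 3 / 3) + z * t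
      - (t\<^sup>2 - t\<^sup>2 * w / l)" for t
  define F2 where "F2 t = a * (t - t\<^sup>2 / (2 * l)) + b * t\<^sup>2 / (2 * l) + m * (t\<^sup>2 * l / 2 - t ^ 3 / 3) + z * t
      - (2 * t * w - t\<^sup>2 * w / l)" for t
  have val: "resistance \<Gamma> (Inner e t) y = (1 - t / l) * a + t / l * b + m * t * (l - t) + z - 2 * (min t w - t * w / l)"
    if "0 < t" "t < l" for t
    using resistance_Inner[OF e that[unfolded l_def] y] unfolding defs .
  have "has_bochner_integral (restrict_space lborel {0<..<l}) (\<lambda>t. resistance \<Gamma> (Inner e t) y)
      (F1 w - F1 0 + (F2 l - F2 w))"
  proof (rule has_bochner_integral_piecewise[OF w])
    show "(F1 has_real_derivative (1 - t / l) * a + t / l * b + m * t * (l - t) + z - 2 * (t - t * w / l)) (at t)" for t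
      unfolding F1_def using l by (auto intro!: derivative_eq_intros simp: field_simps power2_eq_square)
    show "(F2 has_real_derivative (1 - t / l) * a + t / l * b + m * t * (l - t) + z - 2 * (w - t * w / l)) (at t)" for t
      unfolding F2_def using l by (auto intro!: derivative_eq_intros simp: field_simps power2_eq_square)
  qed (use l w in \<open>auto simp: val intro!: continuous_intros\<close>)
  also have "F1 w - F1 0 + (F2 l - F2 w) = (a + b) * l / 2 + m * l ^ 3 / 6 + z * l - w * (l - w)"
    using l by (simp add: F1_def F2_def field_simps power2_eq_square power3_eq_cube)
  finally show ?thesis unfolding defs .
qed

lemma has_bochner_integral_resistance_deriv:
  assumes e: "e \<in> arcs (gr \<Gamma>)" and y: "y \<in> points \<Gamma>"
  shows "has_bochner_integral (open_edge \<Gamma> e) (\<lambda>t. (resistance_deriv \<Gamma> y (Inner e t))\<^sup>2)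
     ((profile y (tail (gr \<Gamma>) e) - profile y (head (gr \<Gamma>) e))\<^sup>2 / len \<Gamma> e + (density e)\<^sup>2 * len \<Gamma> e ^ 3 / 3
      + 4 * slot e y * (len \<Gamma> e - slot e y) * (1 / len \<Gamma> e - density e))"
proof -
  define l w a b m z where "l = len \<Gamma> e" and "w = slot e y" and "a = profile y (tail (gr \<Gamma>) e)"
    and "b = profile y (head (gr \<Gamma>) e)" and "m = density e" and "z = bump y"
  note defs = l_def[symmetric] w_def[symmetric] a_def[symmetric] b_def[symmetric] m_def[symmetric] z_def[symmetric]
  have l: "0 < l" using len_pos[OF e] by (simp add: l_def)
  have w: "0 \<le> w" "w \<le> l" using slot_bounds[OF e y] by (simp_all add: l_def w_def)
  have val: "resistance \<Gamma> (Inner e t) y = (1 - t / l) * a + t / l * b + m * t * (l - t) + z - 2 * (min t w - t * w / l)"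
    if "0 < t" "t < l" for t
    using resistance_Inner[OF e that[unfolded l_def] y] unfolding defs .
  define P1 where "P1 = (b - a) / l + m * l - 2 * (1 - w / l)"
  define P2 where "P2 = (b - a) / l + m * l + 2 * w / l"
  define F where "F P t = P\<^sup>2 * t - 2 * P * m * t\<^sup>2 + 4 * m\<^sup>2 * t ^ 3 / 3" for P t
  have F: "(F P has_real_derivative (P - 2 * m * t)\<^sup>2) (at t)" for P t
    unfolding F_def by (auto intro!: derivative_eq_intros simp: field_simps power2_eq_square)
  have d1: "resistance_deriv \<Gamma> y (Inner e t) = P1 - 2 * m * t" if t: "0 < t" "t < w" for t
  proof -
    have "((\<lambda>s. (1 - s / l) * a + s / l * b + m * s * (l - s) + z - 2 * (s - s * w / l)) has_real_derivative
        P1 - 2 * m * t) (at t)"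
      unfolding P1_def using l by (auto intro!: derivative_eq_intros simp: field_simps)
    then have "((\<lambda>s. resistance \<Gamma> (Inner e s) y) has_real_derivative P1 - 2 * m * t) (at t)"
      by (rule has_field_derivative_transform_within_open[where S = "{0<..<w}"]) (use t w in \<open>auto simp: val\<close>)
    then show ?thesis by (simp add: resistance_deriv_def DERIV_imp_deriv)
  qed
  have d2: "resistance_deriv \<Gamma> y (Inner e t) = P2 - 2 * m * t" if t: "w < t" "t < l" for t
  proof -
    have "((\<lambda>s. (1 - s / l) * a + s / l * b + m * s * (l - s) + z - 2 * (w - s * w / l)) has_real_derivative
        P2 - 2 * m * t) (at t)"
      unfolding P2_def using l by (auto intro!: derivative_eq_intros simp: field_simps)
    then have "((\<lambda>s. resistance \<Gamma> (Inner e s) y) has_real_derivative P2 - 2 * m * t) (at t)"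
      by (rule has_field_derivative_transform_within_open[where S = "{w<..<l}"]) (use t w in \<open>auto simp: val\<close>)
    then show ?thesis by (simp add: resistance_deriv_def DERIV_imp_deriv)
  qed
  have "has_bochner_integral (restrict_space lborel {0<..<l}) (\<lambda>t. (resistance_deriv \<Gamma> y (Inner e t))\<^sup>2)
      (F P1 w - F P1 0 + (F P2 l - F P2 w))"
    by (rule has_bochner_integral_piecewise[OF w F F]) (auto simp: d1 d2)
  also have "F P1 w - F P1 0 + (F P2 l - F P2 w) =
      (a - b)\<^sup>2 / l + m\<^sup>2 * l ^ 3 / 3 + 4 * w * (l - w) * (1 / l - m)"
    using l by (simp add: F_def P1_def P2_def field_simps power2_eq_square power3_eq_cube)
  finally show ?thesis unfolding defs .
qed

section \<open>The tau constant\<close>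

lemma sum_weight: "y \<in> points \<Gamma> \<Longrightarrow> (\<Sum>v\<in>verts (gr \<Gamma>). \<phi> v * weight y v) = interp \<phi> y"
proof -
  have delta: "(\<Sum>v\<in>verts (gr \<Gamma>). \<phi> v * (k * of_bool (p = v))) = k * \<phi> p" if "p \<in> verts (gr \<Gamma>)" for k p
  proof -
    have "(\<Sum>v\<in>verts (gr \<Gamma>). \<phi> v * (k * of_bool (p = v))) = (\<Sum>v\<in>verts (gr \<Gamma>). if p = v then k * \<phi> p else 0)"
      by (intro sum.cong) auto
    then show ?thesis using that by simp
  qed
  assume y: "y \<in> points \<Gamma>"
  show ?thesis
  proof (cases y)
    case (Vertex p)
    then have "p \<in> verts (gr \<Gamma>)" using y by (auto simp: points_def)
    from delta[OF this, of 1] show ?thesis by (simp add: Vertex weight_def)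
  next
    case (Inner e t)
    then have e: "e \<in> arcs (gr \<Gamma>)" using y by (auto simp: points_def)
    have "(\<Sum>v\<in>verts (gr \<Gamma>). \<phi> v * weight y v) =
      (\<Sum>v\<in>verts (gr \<Gamma>). \<phi> v * ((1 - t / len \<Gamma> e) * of_bool (tail (gr \<Gamma>) e = v))) +
      (\<Sum>v\<in>verts (gr \<Gamma>). \<phi> v * (t / len \<Gamma> e * of_bool (head (gr \<Gamma>) e = v)))"
      by (simp only: Inner weight_def interp_simps distrib_left sum.distrib)
    then show ?thesis using e by (simp only: delta tail_in_verts head_in_verts Inner interp_simps)
  qed
qed

text \<open>Reciprocity for the potentials with poles \<open>x\<close> and \<open>y\<close> shows that this weighted sum does not depend on
  the pole; a quarter of it is the contribution of the vertices to \<open>tau\<close>.\<close>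

definition kirchhoff :: "('v, 'e) point \<Rightarrow> real" where
  "kirchhoff y = (\<Sum>v\<in>verts (gr \<Gamma>). c v * profile y v)"

lemma sum_profile_net:
  assumes "x \<in> points \<Gamma>" "y \<in> points \<Gamma>"
  shows "(\<Sum>v\<in>verts (gr \<Gamma>). profile x v * net_current (gr \<Gamma>) (len \<Gamma>) (profile y) v) =
    kirchhoff x - 2 * interp (profile x) y"
proof -
  have "(\<Sum>v\<in>verts (gr \<Gamma>). profile x v * net_current (gr \<Gamma>) (len \<Gamma>) (profile y) v) =
      (\<Sum>v\<in>verts (gr \<Gamma>). c v * profile x v - 2 * (profile x v * weight y v))"
    using assms by (intro sum.cong) (simp_all add: net_profile algebra_simps)
  then show ?thesis
    using sum_weight[OF assms(2)] by (simp add: kirchhoff_def sum_subtractf sum_distrib_left[symmetric])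
qed

lemma kirchhoff_const:
  assumes "x \<in> points \<Gamma>" "y \<in> points \<Gamma>"
  shows "kirchhoff x = kirchhoff y"
  using sum_profile_net[OF assms] sum_profile_net[OF assms(2,1)] interp_profile_sym[OF assms]
    net_current_reciprocity[OF fin_gr, of "profile x" "len \<Gamma>" "profile y"] by simp

lemma sum_ends:
  "(\<Sum>p\<in>verts (gr \<Gamma>). \<phi> p * ((\<Sum>e | e \<in> arcs (gr \<Gamma>) \<and> tail (gr \<Gamma>) e = p. F e) +
     (\<Sum>e | e \<in> arcs (gr \<Gamma>) \<and> head (gr \<Gamma>) e = p. F e))) =
   (\<Sum>e\<in>arcs (gr \<Gamma>). F e * (\<phi> (tail (gr \<Gamma>) e) + \<phi> (head (gr \<Gamma>) e)) :: real)"
proof -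
  have 1: "(\<Sum>p\<in>verts (gr \<Gamma>). \<Sum>e | e \<in> arcs (gr \<Gamma>) \<and> tail (gr \<Gamma>) e = p. \<phi> p * F e) =
        (\<Sum>e\<in>arcs (gr \<Gamma>). F e * \<phi> (tail (gr \<Gamma>) e))"
    by (subst sum.group[where g = "tail (gr \<Gamma>)" and T = "verts (gr \<Gamma>)" and S = "arcs (gr \<Gamma>)", symmetric])
       (auto intro!: sum.cong)
  have 2: "(\<Sum>p\<in>verts (gr \<Gamma>). \<Sum>e | e \<in> arcs (gr \<Gamma>) \<and> head (gr \<Gamma>) e = p. \<phi> p * F e) =
        (\<Sum>e\<in>arcs (gr \<Gamma>). F e * \<phi> (head (gr \<Gamma>) e))"
    by (subst sum.group[where g = "head (gr \<Gamma>)" and T = "verts (gr \<Gamma>)" and S = "arcs (gr \<Gamma>)", symmetric])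
       (auto intro!: sum.cong)
  show ?thesis
    unfolding distrib_left sum.distrib sum_distrib_left 1 2 by simp
qed

lemma valence_eq_sum:
  "real (valence \<Gamma> p) = (\<Sum>e | e \<in> arcs (gr \<Gamma>) \<and> tail (gr \<Gamma>) e = p. 1) +
     (\<Sum>e | e \<in> arcs (gr \<Gamma>) \<and> head (gr \<Gamma>) e = p. 1)"
  by (simp add: valence_def)

text \<open>Kirchhoff's law at the pole itself determines \<open>c\<close>.\<close>

lemma c_eq:
  assumes p: "p \<in> verts (gr \<Gamma>)"
  shows "c p = 2 - real (valence \<Gamma> p) +
     ((\<Sum>e | e \<in> arcs (gr \<Gamma>) \<and> tail (gr \<Gamma>) e = p. len \<Gamma> e * density e) +
      (\<Sum>e | e \<in> arcs (gr \<Gamma>) \<and> head (gr \<Gamma>) e = p. len \<Gamma> e * density e))"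
proof -
  have d: "r (tail (gr \<Gamma>) e) (head (gr \<Gamma>) e) / len \<Gamma> e = 1 - len \<Gamma> e * density e" if "e \<in> arcs (gr \<Gamma>)" for e
    using len_pos[OF that] by (simp add: density_def)
  have t: "(r p p - r (head (gr \<Gamma>) e) p) / len \<Gamma> e = len \<Gamma> e * density e - 1"
    if "e \<in> arcs (gr \<Gamma>)" "tail (gr \<Gamma>) e = p" for e
    using d[OF that(1)] r_sym[of p "head (gr \<Gamma>) e"] that p by (simp add: r_diag)
  have h: "(r p p - r (tail (gr \<Gamma>) e) p) / len \<Gamma> e = len \<Gamma> e * density e - 1"
    if "e \<in> arcs (gr \<Gamma>)" "head (gr \<Gamma>) e = p" for e
    using d[OF that(1)] that p by (simp add: r_diag)
  have "c p - 2 = net_current (gr \<Gamma>) (len \<Gamma>) (\<lambda>v. r v p) p"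
    using p by (simp add: net_r)
  also have "\<dots> = (\<Sum>e | e \<in> arcs (gr \<Gamma>) \<and> tail (gr \<Gamma>) e = p. len \<Gamma> e * density e - 1) +
      (\<Sum>e | e \<in> arcs (gr \<Gamma>) \<and> head (gr \<Gamma>) e = p. len \<Gamma> e * density e - 1)"
    unfolding net_current_def by (intro arg_cong2[of _ _ _ _ "(+)"] sum.cong refl) (auto simp: t h)
  finally show ?thesis
    by (simp add: valence_eq_sum sum_subtractf)
qed

text \<open>On each edge the square of the derivative integrates to the energy of the linear interpolation, the
  energy of the parabola, and a contribution of the kink. Summed over the edges, the first term is
  \<open>kirchhoff y\<close> minus twice the interpolated resistance of \<open>y\<close> with itself, and since the kernel vanishes
  on the diagonal this last quantity is exactly the contribution of the kink.\<close>

theorem tau_eq: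
  assumes y: "y \<in> points \<Gamma>"
  shows "tau \<Gamma> y = kirchhoff y / 4 + (\<Sum>e\<in>arcs (gr \<Gamma>). (density e)\<^sup>2 * len \<Gamma> e ^ 3) / 12"
proof -
  note I = has_bochner_integral_resistance_deriv[OF _ y, unfolded has_bochner_integral_iff]
  have "4 * tau \<Gamma> y = (\<Sum>e\<in>arcs (gr \<Gamma>). \<integral>t. (resistance_deriv \<Gamma> y (Inner e t))\<^sup>2 \<partial>open_edge \<Gamma> e)"
    unfolding tau_def length_measure_def using I by (subst integral_graph_measure[OF fin_gr]) auto
  also have "\<dots> = (\<Sum>e\<in>arcs (gr \<Gamma>).
      (profile y (tail (gr \<Gamma>) e) - profile y (head (gr \<Gamma>) e)) * (profile y (tail (gr \<Gamma>) e) - profile y (head (gr \<Gamma>) e)) / len \<Gamma> e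
      + (density e)\<^sup>2 * len \<Gamma> e ^ 3 / 3
      + 4 * slot e y * (len \<Gamma> e - slot e y) * (1 / len \<Gamma> e - density e))"
    using I by (intro sum.cong refl) (auto simp: power2_eq_square)
  also have "\<dots> = (kirchhoff y - 2 * interp (profile y) y)
      + (\<Sum>e\<in>arcs (gr \<Gamma>). (density e)\<^sup>2 * len \<Gamma> e ^ 3) / 3
      + (case y of Vertex p \<Rightarrow> 0 | Inner e w \<Rightarrow> 4 * w * (len \<Gamma> e - w) * (1 / len \<Gamma> e - density e))"
    unfolding sum.distrib sum_net_current[OF fin_gr, symmetric] sum_profile_net[OF y y]
    by (subst sum_slot[OF y, where F = "\<lambda>e w. 4 * w * (len \<Gamma> e - w) * (1 / len \<Gamma> e - density e)"])
       (simp_all add: sum_divide_distrib)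
  also have "2 * interp (profile y) y =
      (case y of Vertex p \<Rightarrow> 0 | Inner e w \<Rightarrow> 4 * w * (len \<Gamma> e - w) * (1 / len \<Gamma> e - density e))"
    using kernel_self[OF y] len_pos y
    by (cases y) (auto simp: kernel_def bump_def green_def points_def field_simps simp del: interp_simps)
  finally show ?thesis by simp
qed

section \<open>Integrals against the canonical and the admissible measure\<close>

lemma sum_c:
  assumes y: "y \<in> points \<Gamma>"
  shows "(\<Sum>p\<in>verts (gr \<Gamma>). c p) = 2"
proof -
  have "0 = (\<Sum>p\<in>verts (gr \<Gamma>). 1 * net_current (gr \<Gamma>) (len \<Gamma>) (profile y) p)"
    by (simp only: sum_net_current[OF fin_gr]) simp
  also have "\<dots> = (\<Sum>p\<in>verts (gr \<Gamma>). c p - 2 * (1 * weight y p))"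
    using y by (intro sum.cong) (simp_all add: net_profile)
  also have "\<dots> = (\<Sum>p\<in>verts (gr \<Gamma>). c p) - 2 * interp (\<lambda>_. 1) y"
    using sum_weight[OF y, of "\<lambda>_. 1"] by (simp add: sum_subtractf sum_distrib_left[symmetric])
  also have "interp (\<lambda>_. 1) y = 1"
    by (cases y) auto
  finally show ?thesis by simp
qed

lemma sum_valence: "(\<Sum>p\<in>verts (gr \<Gamma>). real (valence \<Gamma> p)) = 2 * real (card (arcs (gr \<Gamma>)))"
  using sum_ends[of "\<lambda>_. 1" "\<lambda>_. 1"] by (simp add: valence_eq_sum)

text \<open>Foster's identity: the interpolated canonical measure has total mass \<open>1\<close>.\<close>

lemma foster:
  assumes y: "y \<in> points \<Gamma>"
  shows "(\<Sum>e\<in>arcs (gr \<Gamma>). len \<Gamma> e * density e) = of_int (betti \<Gamma>)"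
proof -
  have "2 = (\<Sum>p\<in>verts (gr \<Gamma>). c p)"
    by (rule sum_c[OF y, symmetric])
  also have "\<dots> = (\<Sum>p\<in>verts (gr \<Gamma>). 2 - real (valence \<Gamma> p) + 1 *
     ((\<Sum>e | e \<in> arcs (gr \<Gamma>) \<and> tail (gr \<Gamma>) e = p. len \<Gamma> e * density e) +
      (\<Sum>e | e \<in> arcs (gr \<Gamma>) \<and> head (gr \<Gamma>) e = p. len \<Gamma> e * density e)))"
    by (intro sum.cong) (simp_all add: c_eq)
  also have "\<dots> = 2 * real (card (verts (gr \<Gamma>))) - 2 * real (card (arcs (gr \<Gamma>))) +
      (\<Sum>e\<in>arcs (gr \<Gamma>). len \<Gamma> e * density e * (1 + 1))"
    unfolding sum.distrib sum_subtractf sum_valence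
    by (subst sum_ends[of "\<lambda>_. 1"]) simp
  also have "(\<Sum>e\<in>arcs (gr \<Gamma>). len \<Gamma> e * density e * (1 + 1)) = 2 * (\<Sum>e\<in>arcs (gr \<Gamma>). len \<Gamma> e * density e)"
    by (simp add: sum_distrib_left mult.commute)
  finally show ?thesis
    by (simp add: betti_def)
qed

lemma resistance_Vertex:
  assumes "p \<in> verts (gr \<Gamma>)" "y \<in> points \<Gamma>"
  shows "resistance \<Gamma> (Vertex p) y = profile y p + bump y"
proof -
  have "Vertex p \<in> points \<Gamma>"
    using assms(1) by (simp add: points_def)
  then show ?thesis
    using assms(2) by (simp add: resistance_eq_kernel kernel_def bump_def)
qed

lemma resistance_Vertex_Vertex:
  assumes "p \<in> verts (gr \<Gamma>)" "q \<in> verts (gr \<Gamma>)"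
  shows "resistance \<Gamma> (Vertex p) (Vertex q) = r p q"
  using assms by (simp add: resistance_Vertex points_def profile_def bump_def)

lemma resistance_sym:
  "x \<in> points \<Gamma> \<Longrightarrow> y \<in> points \<Gamma> \<Longrightarrow> resistance \<Gamma> x y = resistance \<Gamma> y x"
  by (simp add: resistance_eq_kernel kernel_sym)

lemma integrable_resistance:
  "e \<in> arcs (gr \<Gamma>) \<Longrightarrow> y \<in> points \<Gamma> \<Longrightarrow> integrable (open_edge \<Gamma> e) (\<lambda>t. resistance \<Gamma> (Inner e t) y)"
  using has_bochner_integral_resistance by (simp add: has_bochner_integral_iff)

text \<open>This says that the resistance function integrates to \<open>2 * tau \<Gamma> y\<close> against the canonical measure,
  which has density \<open>density e\<close> on the edges and mass \<open>1 - valence \<Gamma> p / 2\<close> at the vertices, so the integral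
  is the same for all \<open>y\<close>. The parabola in \<open>y\<close> disappears by Foster's identity.\<close>

theorem density_integral:
  assumes y: "y \<in> points \<Gamma>"
  shows "(\<Sum>e\<in>arcs (gr \<Gamma>). density e * (\<integral>t. resistance \<Gamma> (Inner e t) y \<partial>open_edge \<Gamma> e)) =
     2 * tau \<Gamma> y + (\<Sum>p\<in>verts (gr \<Gamma>). (real (valence \<Gamma> p) - 2) * resistance \<Gamma> (Vertex p) y) / 2"
proof -
  let ?V = "verts (gr \<Gamma>)" and ?E = "arcs (gr \<Gamma>)"
  let ?m = density and ?L = "len \<Gamma>" and ?a = "\<lambda>e. profile y (tail (gr \<Gamma>) e)" and ?b = "\<lambda>e. profile y (head (gr \<Gamma>) e)"
  have "(\<Sum>e\<in>?E. ?m e * (\<integral>t. resistance \<Gamma> (Inner e t) y \<partial>open_edge \<Gamma> e)) =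
      (\<Sum>e\<in>?E. 1 / 2 * (?L e * ?m e * (?a e + ?b e)) + 1 / 6 * ((?m e)\<^sup>2 * ?L e ^ 3)
        + bump y * (?L e * ?m e) - ?m e * slot e y * (?L e - slot e y))"
  proof (intro sum.cong refl)
    fix e assume "e \<in> ?E"
    from has_bochner_integral_resistance[OF this y]
    have I: "(\<integral>t. resistance \<Gamma> (Inner e t) y \<partial>open_edge \<Gamma> e) =
      (?a e + ?b e) * ?L e / 2 + ?m e * ?L e ^ 3 / 6 + bump y * ?L e - slot e y * (?L e - slot e y)"
      by (simp add: has_bochner_integral_iff)
    show "?m e * (\<integral>t. resistance \<Gamma> (Inner e t) y \<partial>open_edge \<Gamma> e) =
      1 / 2 * (?L e * ?m e * (?a e + ?b e)) + 1 / 6 * ((?m e)\<^sup>2 * ?L e ^ 3)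
        + bump y * (?L e * ?m e) - ?m e * slot e y * (?L e - slot e y)"
      unfolding I by (simp add: algebra_simps add_divide_distrib power2_eq_square power3_eq_cube)
  qed
  also have "\<dots> = 1 / 2 * (\<Sum>e\<in>?E. ?L e * ?m e * (?a e + ?b e)) + 1 / 6 * (\<Sum>e\<in>?E. (?m e)\<^sup>2 * ?L e ^ 3)
      + bump y * of_int (betti \<Gamma>) - bump y"
    unfolding sum.distrib sum_subtractf sum_distrib_left[symmetric] foster[OF y]
    by (subst sum_slot[OF y, where F = "\<lambda>e w. ?m e * w * (?L e - w)"]) (simp_all add: bump_def)
  also have "(\<Sum>e\<in>?E. ?L e * ?m e * (?a e + ?b e)) =
      kirchhoff y + (\<Sum>p\<in>?V. (real (valence \<Gamma> p) - 2) * profile y p)"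
    unfolding sum_ends[of "profile y" "\<lambda>e. ?L e * ?m e", symmetric] kirchhoff_def sum.distrib[symmetric]
    by (intro sum.cong refl) (simp add: c_eq algebra_simps)
  also have "(\<Sum>p\<in>?V. (real (valence \<Gamma> p) - 2) * profile y p) =
      (\<Sum>p\<in>?V. (real (valence \<Gamma> p) - 2) * resistance \<Gamma> (Vertex p) y) - bump y * (\<Sum>p\<in>?V. real (valence \<Gamma> p) - 2)"
    unfolding sum_distrib_left sum_subtractf[symmetric]
    using y by (intro sum.cong refl) (simp add: resistance_Vertex algebra_simps)
  also have "(\<Sum>p\<in>?V. real (valence \<Gamma> p) - 2) = 2 * of_int (betti \<Gamma>) - 2"
    by (simp add: sum_subtractf sum_valence betti_def)
  finally show ?thesis
    using tau_eq[OF y] by (simp add: algebra_simps)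
qed

lemma tau_const:
  assumes "x \<in> points \<Gamma>" "y \<in> points \<Gamma>"
  shows "tau \<Gamma> x = tau \<Gamma> y"
  using assms kirchhoff_const[OF assms] by (simp add: tau_eq)

end

text \<open>Positive densities exclude bridges, for which the deleted resistance is infinite.\<close>

locale polarized_kernel = resistance_kernel +
  assumes density_pos: "\<And>e. e \<in> arcs (gr \<Gamma>) \<Longrightarrow> 0 < density e"
    and canonical_nonneg: "\<And>p. p \<in> verts (gr \<Gamma>) \<Longrightarrow> 0 \<le> canonical \<Gamma> p"
    and genus_pos: "0 < genus \<Gamma>"
begin

lemma integral_canonical_measure:
  fixes f :: "_ \<Rightarrow> real"
  assumes "\<And>e. e \<in> arcs (gr \<Gamma>) \<Longrightarrow> integrable (open_edge \<Gamma> e) (\<lambda>t. f (Inner e t))"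
  shows "(\<integral>x. f x \<partial>canonical_measure \<Gamma>) = (\<Sum>p\<in>verts (gr \<Gamma>). of_int (canonical \<Gamma> p) * f (Vertex p))"
  unfolding canonical_measure_def using assms canonical_nonneg
  by (subst integral_graph_measure[OF fin_gr]) auto

lemma
  fixes f :: "_ \<Rightarrow> real"
  assumes f: "\<And>e. e \<in> arcs (gr \<Gamma>) \<Longrightarrow> integrable (open_edge \<Gamma> e) (\<lambda>t. f (Inner e t))"
  shows integral_admissible_measure: "(\<integral>x. f x \<partial>admissible_measure \<Gamma>) =
     ((\<Sum>p\<in>verts (gr \<Gamma>). real (pol \<Gamma> p) * f (Vertex p)) +
      (\<Sum>e\<in>arcs (gr \<Gamma>). density e * (\<integral>t. f (Inner e t) \<partial>open_edge \<Gamma> e))) / of_int (genus \<Gamma>)"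
    and integrable_admissible_measure: "integrable (admissible_measure \<Gamma>) f"
proof -
  have dens: "real_of_ereal (1 / (ereal (len \<Gamma> e) + deleted_resistance \<Gamma> e)) = density e"
    if "e \<in> arcs (gr \<Gamma>)" for e
    using density_pos[OF that] by (simp add: deleted_resistance_eq[OF that] one_ereal_def)
  have nonneg: "0 \<le> real_of_ereal (1 / (ereal (len \<Gamma> e) + deleted_resistance \<Gamma> e)) / of_int (genus \<Gamma>)"
    if "e \<in> arcs (gr \<Gamma>)" for e
    using density_pos[OF that] genus_pos by (simp add: dens[OF that])
  show "integrable (admissible_measure \<Gamma>) f"
    unfolding admissible_measure_def using f nonneg genus_pos
    by (intro integrable_graph_measure[OF fin_gr]) auto
  show "(\<integral>x. f x \<partial>admissible_measure \<Gamma>) =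
     ((\<Sum>p\<in>verts (gr \<Gamma>). real (pol \<Gamma> p) * f (Vertex p)) +
      (\<Sum>e\<in>arcs (gr \<Gamma>). density e * (\<integral>t. f (Inner e t) \<partial>open_edge \<Gamma> e))) / of_int (genus \<Gamma>)"
    unfolding admissible_measure_def using f nonneg genus_pos
    by (subst integral_graph_measure[OF fin_gr]) (auto simp: dens add_divide_distrib sum_divide_distrib)
qed

text \<open>The measure \<open>\<mu>\<^sub>a\<^sub>d\<close> scaled by the genus is the canonical measure plus half the point masses of the
  canonical divisor.\<close>

theorem integral_resistance_admissible:
  assumes y: "y \<in> points \<Gamma>"
  shows "(\<integral>x. resistance \<Gamma> x y \<partial>admissible_measure \<Gamma>) =
    (2 * tau \<Gamma> y + (\<Sum>p\<in>verts (gr \<Gamma>). of_int (canonical \<Gamma> p) * resistance \<Gamma> (Vertex p) y) / 2) / of_int (genus \<Gamma>)"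
proof -
  have "(\<Sum>p\<in>verts (gr \<Gamma>). of_int (canonical \<Gamma> p) * resistance \<Gamma> (Vertex p) y) =
      (\<Sum>p\<in>verts (gr \<Gamma>). (real (valence \<Gamma> p) - 2) * resistance \<Gamma> (Vertex p) y) +
      2 * (\<Sum>p\<in>verts (gr \<Gamma>). real (pol \<Gamma> p) * resistance \<Gamma> (Vertex p) y)"
    unfolding sum_distrib_left sum.distrib[symmetric]
    by (intro sum.cong refl) (simp add: canonical_def algebra_simps)
  then show ?thesis
    using integral_admissible_measure[OF integrable_resistance, OF _ y] density_integral[OF y]
    by simp
qed

lemma sum_canonical:
  "(\<Sum>p\<in>verts (gr \<Gamma>). real_of_int (canonical \<Gamma> p)) = 2 * of_int (genus \<Gamma>) - 2"
  by (simp add: canonical_def sum.distrib sum_subtractf sum_valence genus_def betti_def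
      sum_distrib_left[symmetric])

lemma integral_canonical_potential:
  assumes y: "y \<in> points \<Gamma>"
  shows "(\<integral>x. resistance \<Gamma> x y \<partial>canonical_measure \<Gamma>) =
    (\<Sum>p\<in>verts (gr \<Gamma>). of_int (canonical \<Gamma> p) * resistance \<Gamma> y (Vertex p))"
proof -
  have "Vertex p \<in> points \<Gamma>" if "p \<in> verts (gr \<Gamma>)" for p
    using that by (simp add: points_def)
  then show ?thesis
    using integral_canonical_measure[OF integrable_resistance, OF _ y] y
    by (auto intro!: sum.cong simp: resistance_sym[of y])
qed

lemma space_admissible_measure[simp]: "space (admissible_measure \<Gamma>) = points \<Gamma>"
  by (simp add: admissible_measure_def)

text \<open>Integrating the potential of \<open>\<mu>\<^sub>a\<^sub>d\<close> against the canonical divisor, which has degree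
  \<open>2 * genus \<Gamma> - 2\<close>, turns the vertex sum into \<open>theta\<close>.\<close>

theorem epsilon_eq:
  assumes y: "y \<in> points \<Gamma>"
  shows "epsilon_inv \<Gamma> = ((4 * of_int (genus \<Gamma>) - 4) * tau \<Gamma> y + theta \<Gamma> / 2) / of_int (genus \<Gamma>)"
proof -
  have V: "Vertex p \<in> points \<Gamma>" if "p \<in> verts (gr \<Gamma>)" for p
    using that by (simp add: points_def)
  let ?K = "\<lambda>p. real_of_int (canonical \<Gamma> p)"
  have "epsilon_inv \<Gamma> =
      (\<integral>z. (\<Sum>p\<in>verts (gr \<Gamma>). ?K p * resistance \<Gamma> z (Vertex p)) \<partial>admissible_measure \<Gamma>)"
    unfolding epsilon_inv_def by (intro Bochner_Integration.integral_cong refl integral_canonical_potential) simp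
  also have "\<dots> = (\<Sum>p\<in>verts (gr \<Gamma>). ?K p * (\<integral>z. resistance \<Gamma> z (Vertex p) \<partial>admissible_measure \<Gamma>))"
    using V by (subst Bochner_Integration.integral_sum)
      (auto intro!: integrable_admissible_measure integrable_resistance)
  also have "\<dots> = (\<Sum>p\<in>verts (gr \<Gamma>). (?K p * (2 * tau \<Gamma> y) +
      (\<Sum>q\<in>verts (gr \<Gamma>). ?K q * ?K p * resistance \<Gamma> (Vertex q) (Vertex p)) / 2) / of_int (genus \<Gamma>))"
  proof (intro sum.cong refl)
    fix p assume "p \<in> verts (gr \<Gamma>)"
    then have p: "Vertex p \<in> points \<Gamma>" by (rule V)
    show "?K p * (\<integral>z. resistance \<Gamma> z (Vertex p) \<partial>admissible_measure \<Gamma>) = (?K p * (2 * tau \<Gamma> y) +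
      (\<Sum>q\<in>verts (gr \<Gamma>). ?K q * ?K p * resistance \<Gamma> (Vertex q) (Vertex p)) / 2) / of_int (genus \<Gamma>)"
      unfolding integral_resistance_admissible[OF p] tau_const[OF p y]
      by (simp add: distrib_left sum_distrib_left mult.assoc mult.left_commute)
  qed
  also have "\<dots> = ((\<Sum>p\<in>verts (gr \<Gamma>). ?K p) * (2 * tau \<Gamma> y) + theta \<Gamma> / 2) / of_int (genus \<Gamma>)"
    unfolding theta_def sum_divide_distrib[symmetric] sum.distrib sum_distrib_right[symmetric]
    by (subst sum.swap) simp
  finally show ?thesis
    by (simp add: sum_canonical algebra_simps)
qed

text \<open>Integrating the potential of \<open>\<mu>\<^sub>a\<^sub>d\<close> against \<open>\<mu>\<^sub>a\<^sub>d\<close> itself, which has mass \<open>1\<close> by Foster's identity,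
  turns the vertex sum into \<open>epsilon_inv\<close>.\<close>

theorem Z_eq:
  assumes y: "y \<in> points \<Gamma>"
  shows "Z_inv \<Gamma> = (2 * tau \<Gamma> y + epsilon_inv \<Gamma> / 2) / (2 * of_int (genus \<Gamma>))"
proof -
  let ?K = "\<lambda>p. real_of_int (canonical \<Gamma> p)"
  let ?g = "real_of_int (genus \<Gamma>)"
  have V: "Vertex p \<in> points \<Gamma>" if "p \<in> verts (gr \<Gamma>)" for p
    using that by (simp add: points_def)
  let ?S = "\<lambda>z. \<Sum>p\<in>verts (gr \<Gamma>). ?K p * resistance \<Gamma> z (Vertex p)"
  have const: "integrable (open_edge \<Gamma> e) (\<lambda>t. k)" "(\<integral>t. k \<partial>open_edge \<Gamma> e) = len \<Gamma> e * k"
    if "e \<in> arcs (gr \<Gamma>)" for e and k :: real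
    using len_pos[OF that] by (auto simp: integrable_restrict_space measure_restrict_space)
  have mass: "(\<integral>z. k \<partial>admissible_measure \<Gamma>) = k" for k :: real
  proof -
    have edge: "density e * (\<integral>t. k \<partial>open_edge \<Gamma> e) = len \<Gamma> e * density e * k" if "e \<in> arcs (gr \<Gamma>)" for e
      unfolding const(2)[OF that] by simp
    have "(\<integral>z. k \<partial>admissible_measure \<Gamma>) = ((\<Sum>p\<in>verts (gr \<Gamma>). real (pol \<Gamma> p) * k) +
        (\<Sum>e\<in>arcs (gr \<Gamma>). density e * (\<integral>t. k \<partial>open_edge \<Gamma> e))) / ?g"
      by (rule integral_admissible_measure) (rule const(1))
    also have "\<dots> =
      ((\<Sum>p\<in>verts (gr \<Gamma>). real (pol \<Gamma> p) * k) + (\<Sum>e\<in>arcs (gr \<Gamma>). len \<Gamma> e * density e * k)) / ?g"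
      by (simp only: edge cong: sum.cong)
    also have "\<dots> = k * (of_int (betti \<Gamma>) + (\<Sum>p\<in>verts (gr \<Gamma>). real (pol \<Gamma> p))) / ?g"
      unfolding sum_distrib_right[symmetric] foster[OF y] by (simp add: algebra_simps)
    also have "of_int (betti \<Gamma>) + (\<Sum>p\<in>verts (gr \<Gamma>). real (pol \<Gamma> p)) = ?g"
      by (simp add: genus_def)
    also have "k * ?g / ?g = k"
      using genus_pos by simp
    finally show ?thesis .
  qed
  have S: "integrable (admissible_measure \<Gamma>) (\<lambda>z. ?S z)"
    using V by (intro integrable_admissible_measure Bochner_Integration.integrable_sum
        integrable_mult_right integrable_resistance) auto
  have k: "integrable (admissible_measure \<Gamma>) (\<lambda>z. k)" for k :: real
    using const by (intro integrable_admissible_measure)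
  have eps: "epsilon_inv \<Gamma> = (\<integral>z. ?S z \<partial>admissible_measure \<Gamma>)"
    unfolding epsilon_inv_def by (intro Bochner_Integration.integral_cong refl integral_canonical_potential) simp
  have "Z_inv \<Gamma> = 1 / 2 * (\<integral>z. (2 * tau \<Gamma> y + ?S z / 2) / ?g \<partial>admissible_measure \<Gamma>)"
    unfolding Z_inv_def
  proof (intro arg_cong2[of _ _ _ _ "(*)"] Bochner_Integration.integral_cong refl)
    fix z assume "z \<in> space (admissible_measure \<Gamma>)"
    then have z: "z \<in> points \<Gamma>" by simp
    show "(\<integral>x. resistance \<Gamma> x z \<partial>admissible_measure \<Gamma>) = (2 * tau \<Gamma> y + ?S z / 2) / ?g"
      using integral_resistance_admissible[OF z] tau_const[OF z y] V z
      by (simp add: resistance_sym[of z] cong: sum.cong)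
  qed
  also have "(\<integral>z. (2 * tau \<Gamma> y + ?S z / 2) / ?g \<partial>admissible_measure \<Gamma>) = (2 * tau \<Gamma> y + epsilon_inv \<Gamma> / 2) / ?g"
    using S k by (simp add: mass eps del: lebesgue_integral_const)
  finally show ?thesis by simp
qed

end

section \<open>Types of points\<close>

text \<open>Stated through sets closed under adjacency, so that connectedness of a concrete graph becomes a
  propositional check along its arcs.\<close>

lemma connectedI:
  assumes wf: "wf_digraph G" and v: "v \<in> verts G"
    and closed: "\<And>P. P v \<Longrightarrow> (\<And>a. a \<in> arcs G \<Longrightarrow> P (tail G a) = P (head G a)) \<Longrightarrow> (\<And>u. u \<in> verts G \<Longrightarrow> P u)"
  shows "Digraph_Component.connected G"
proof -
  interpret wf_digraph G by fact
  define R where "R = rtrancl_on (verts G) ((arcs_ends G)\<^sup>s)"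
  have "sym ((arcs_ends G)\<^sup>s)"
    by (auto simp: sym_def symcl_def)
  then have sym: "sym R"
    unfolding R_def by (rule rtrancl_on_sym)
  have reach: "(v, u) \<in> R" if "u \<in> verts G" for u
  proof (rule closed[OF _ _ that, of "\<lambda>u. (v, u) \<in> R"])
    show "(v, v) \<in> R"
      using v unfolding R_def by (rule rtrancl_on_refl)
    fix a assume a: "a \<in> arcs G"
    then have "(tail G a, head G a) \<in> (arcs_ends G)\<^sup>s" "(head G a, tail G a) \<in> (arcs_ends G)\<^sup>s"
      by (force simp: symcl_def arcs_ends_conv)+
    then show "((v, tail G a) \<in> R) = ((v, head G a) \<in> R)"
      using a rtrancl_on_into_rtrancl_on[of v _ "verts G" "(arcs_ends G)\<^sup>s"] unfolding R_def by auto
  qed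
  have "(u, u') \<in> R" if "u \<in> verts G" "u' \<in> verts G" for u u'
    using symD[OF sym reach[OF that(1)]] reach[OF that(2)] unfolding R_def by (rule rtrancl_on_trans)
  then show ?thesis
    unfolding connected_conv using v R_def by auto
qed

text \<open>Without bridges every interior point is of type \<open>0\<close>.\<close>

lemma delta_inv_0:
  assumes fin: "fin_digraph (gr \<Gamma>)" and len: "\<And>e. e \<in> arcs (gr \<Gamma>) \<Longrightarrow> 0 < len \<Gamma> e"
    and cut: "\<And>e t. e \<in> arcs (gr \<Gamma>) \<Longrightarrow> Digraph_Component.connected (gr (cut \<Gamma> e t))"
  shows "delta_inv \<Gamma> 0 = total_length \<Gamma>"
proof -
  have type0: "{x \<in> points \<Gamma>. has_type \<Gamma> x 0} = {x \<in> points \<Gamma>. \<exists>e t. x = Inner e t}" (is "_ = ?I")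
    using cut by (auto simp: has_type_def points_def)
  have trace: "{t. 0 < t \<and> t < len \<Gamma> e \<and> Inner e t \<in> points \<Gamma>} = {0<..<len \<Gamma> e}" if "e \<in> arcs (gr \<Gamma>)" for e
    using that by (auto simp: points_def)
  have "?I \<in> borel_sets \<Gamma>"
    using trace by (auto simp: borel_sets_def)
  then have "emeasure (length_measure \<Gamma>) ?I = (\<Sum>e\<in>arcs (gr \<Gamma>). ennreal (len \<Gamma> e))"
    using len unfolding length_measure_def
    by (subst emeasure_graph_measure[OF fin]) (auto simp: trace less_imp_le intro!: sum.cong)
  also have "\<dots> = ennreal (total_length \<Gamma>)"
    unfolding total_length_def using len by (intro sum_ennreal) (auto intro: less_imp_le)
  finally show ?thesis
    unfolding delta_inv_def type0 using len
    by (simp add: measure_def total_length_def sum_nonneg less_imp_le)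
qed

lemma delta_inv_pos:
  assumes cut: "\<And>e t. e \<in> arcs (gr \<Gamma>) \<Longrightarrow> Digraph_Component.connected (gr (cut \<Gamma> e t))" and i: "i \<noteq> 0"
  shows "delta_inv \<Gamma> i = 0"
proof -
  have none: "{x \<in> points \<Gamma>. has_type \<Gamma> x i} = {}"
    using cut i by (auto simp: has_type_def points_def)
  show ?thesis unfolding delta_inv_def none by simp
qed

section \<open>The graph with two double edges\<close>

lemma UNIV_vertex4: "(UNIV :: vertex4 set) = {P1, P2, P3, P4}"
  using vertex4.exhaust by blast

lemma UNIV_edge6: "(UNIV :: edge6 set) = {EdgeA, EdgeB, EdgeC, EdgeD, EdgeE, EdgeF}"
  using edge6.exhaust by blast

lemma edge6_tail_eq:
  "{x. edge6_tail x = P1} = {EdgeC, EdgeD}" "{x. edge6_tail x = P2} = {EdgeA}"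
  "{x. edge6_tail x = P3} = {EdgeE, EdgeF}" "{x. edge6_tail x = P4} = {EdgeB}"
  by (auto elim: edge6_tail.elims)

lemma edge6_head_eq:
  "{x. edge6_head x = P1} = {EdgeB}" "{x. edge6_head x = P2} = {EdgeC, EdgeD}"
  "{x. edge6_head x = P3} = {EdgeA}" "{x. edge6_head x = P4} = {EdgeE, EdgeF}"
  by (auto elim: edge6_head.elims)

locale double_edges =
  fixes a b c d e f :: real
  assumes pos: "0 < a" "0 < b" "0 < c" "0 < d" "0 < e" "0 < f"
begin

abbreviation "\<Gamma> \<equiv> two_double_edges a b c d e f"

lemma \<Gamma>_simps[simp]:
  "verts (gr \<Gamma>) = UNIV" "arcs (gr \<Gamma>) = UNIV" "tail (gr \<Gamma>) = edge6_tail" "head (gr \<Gamma>) = edge6_head"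
  "pol \<Gamma> p = 0" "len \<Gamma> EdgeA = a" "len \<Gamma> EdgeB = b" "len \<Gamma> EdgeC = c" "len \<Gamma> EdgeD = d"
  "len \<Gamma> EdgeE = e" "len \<Gamma> EdgeF = f"
  by (simp_all add: two_double_edges_def)

lemma fin_\<Gamma>: "fin_digraph (gr \<Gamma>)"
  by unfold_locales (simp, simp, simp add: UNIV_vertex4, simp add: UNIV_edge6)

lemma connected_\<Gamma>: "Digraph_Component.connected (gr \<Gamma>)"
proof (rule connectedI[where v = P1])
  show "wf_digraph (gr \<Gamma>)" using fin_\<Gamma> by (simp add: fin_digraph_def)
  fix P u assume "P P1" and P: "\<And>a. a \<in> arcs (gr \<Gamma>) \<Longrightarrow> P (tail (gr \<Gamma>) a) = P (head (gr \<Gamma>) a)"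
  with P[of EdgeA] P[of EdgeB] P[of EdgeC] show "P u"
    by (cases u) auto
qed simp

lemma connected_cut: "Digraph_Component.connected (gr (cut \<Gamma> x t))"
proof (rule connectedI[where v = "Inl P1"])
  show "wf_digraph (gr (cut \<Gamma> x t))"
    by unfold_locales (auto simp: cut_def)
  show "Inl P1 \<in> verts (gr (cut \<Gamma> x t))"
    by (simp add: cut_def)
  fix P u assume P1: "P (Inl P1)"
    and P: "\<And>y. y \<in> arcs (gr (cut \<Gamma> x t)) \<Longrightarrow> P (tail (gr (cut \<Gamma> x t)) y) = P (head (gr (cut \<Gamma> x t)) y)"
  \<comment> \<open>The end point of each remaining piece of the cut edge hangs on an old vertex, and the old vertices stay connected without the cut edge.\<close>
  have old: "P (Inl (edge6_tail y)) = P (Inl (edge6_head y))" if "y \<noteq> x" for y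
    using P[of "Inl y"] that by (simp add: cut_def)
  have new: "P (Inl (edge6_tail x)) = P (Inr False)" "P (Inr True) = P (Inl (edge6_head x))"
    using P[of "Inr False"] P[of "Inr True"] by (simp_all add: cut_def)
  have inl: "P (Inl p)" for p
    using P1 old[of EdgeA] old[of EdgeB] old[of EdgeC] old[of EdgeD] old[of EdgeE] old[of EdgeF]
    by (cases x; cases p) auto
  have "P (Inr s)" for s
    using new inl by (cases s) auto
  with inl show "P u"
    by (cases u) auto
qed

text \<open>The resistances of the two parallel pairs. Seen from the four vertices, the graph is a single loop of
  length \<open>S\<close> formed by the resistors \<open>u\<close>, \<open>a\<close>, \<open>w\<close>, \<open>b\<close>.\<close>

definition u where "u = c * d / (c + d)"
definition w where "w = e * f / (e + f)"
definition S where "S = u + a + w + b"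

definition position :: "vertex4 \<Rightarrow> real" where
  "position p = (case p of P1 \<Rightarrow> 0 | P2 \<Rightarrow> u | P3 \<Rightarrow> u + a | P4 \<Rightarrow> u + a + w)"

text \<open>On a loop the two arcs joining two points are resistors in parallel.\<close>

definition res :: "vertex4 \<Rightarrow> vertex4 \<Rightarrow> real" where
  "res p q = \<bar>position p - position q\<bar> * (S - \<bar>position p - position q\<bar>) / S"

definition curv :: "vertex4 \<Rightarrow> real" where
  "curv p = (case p of P1 \<Rightarrow> b + u | P2 \<Rightarrow> u + a | P3 \<Rightarrow> a + w | P4 \<Rightarrow> w + b) / S"

lemma uw_pos: "0 < u" "0 < w" "0 < S" "u < c" "u < d" "w < e" "w < f"
  using pos by (simp_all add: u_def w_def S_def field_simps add_pos_pos)

lemma parallel: "x / c + x / d = x / u" "x / e + x / f = x / w"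
  using pos by (simp_all add: u_def w_def field_simps)

lemma res_simps:
  "res P1 P1 = 0" "res P2 P2 = 0" "res P3 P3 = 0" "res P4 P4 = 0"
  "res P1 P2 = u * (S - u) / S" "res P2 P1 = u * (S - u) / S"
  "res P2 P3 = a * (S - a) / S" "res P3 P2 = a * (S - a) / S"
  "res P3 P4 = w * (S - w) / S" "res P4 P3 = w * (S - w) / S"
  "res P1 P4 = b * (S - b) / S" "res P4 P1 = b * (S - b) / S"
  "res P1 P3 = (u + a) * (w + b) / S" "res P3 P1 = (u + a) * (w + b) / S"
  "res P2 P4 = (a + w) * (u + b) / S" "res P4 P2 = (a + w) * (u + b) / S"
  using pos uw_pos(1-3) by (simp_all add: res_def position_def abs_if S_def algebra_simps)

text \<open>Each parallel pair acts as one resistor.\<close>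

lemma net_current_simps:
  "net_current (gr \<Gamma>) (len \<Gamma>) h P1 = (h P1 - h P2) / u + (h P1 - h P4) / b"
  "net_current (gr \<Gamma>) (len \<Gamma>) h P2 = (h P2 - h P1) / u + (h P2 - h P3) / a"
  "net_current (gr \<Gamma>) (len \<Gamma>) h P3 = (h P3 - h P4) / w + (h P3 - h P2) / a"
  "net_current (gr \<Gamma>) (len \<Gamma>) h P4 = (h P4 - h P3) / w + (h P4 - h P1) / b"
  by (simp_all add: net_current_def edge6_tail_eq edge6_head_eq parallel)

lemma net_res:
  "net_current (gr \<Gamma>) (len \<Gamma>) (\<lambda>v. res v z) p = curv p - 2 * of_bool (p = z)"
proof -
  have "u \<noteq> 0" "w \<noteq> 0" "u + a + w + b \<noteq> 0" using uw_pos by (auto simp: S_def)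
  then show ?thesis
    using pos(1,2)
    by (cases p; cases z)
       (simp_all add: net_current_simps res_simps curv_def S_def divide_simps, simp_all add: algebra_simps)
qed

sublocale K: resistance_kernel \<Gamma> res curv
proof
  show "0 < len \<Gamma> x" for x using pos by (cases x) simp_all
qed (use fin_\<Gamma> net_res res_simps in \<open>auto simp: res_def abs_minus_commute fin_digraph_def fin_digraph_axioms_def wf_digraph_def\<close>)

lemma density_simps:
  "K.density EdgeA = 1 / S" "K.density EdgeB = 1 / S"
  "K.density EdgeC = (1 - u * (S - u) / S / c) / c" "K.density EdgeD = (1 - u * (S - u) / S / d) / d"
  "K.density EdgeE = (1 - w * (S - w) / S / e) / e" "K.density EdgeF = (1 - w * (S - w) / S / f) / f"
  using pos uw_pos by (simp_all add: K.density_def res_simps field_simps)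

lemma density_pos: "0 < K.density x"
proof -
  have "0 < 1 - z * (S - z) / S / l" if "0 < z" "z < l" for z l
  proof -
    have "z * (S - z) / S = z - z * z / S" using uw_pos by (simp add: field_simps)
    also have "\<dots> < l" using that uw_pos(3) by (smt (verit) divide_pos_pos mult_pos_pos)
    finally have "z * (S - z) / S / l < 1"
      using that by (subst divide_less_eq_1_pos) auto
    then show ?thesis by linarith
  qed
  from this[of u c] this[of u d] this[of w e] this[of w f] show ?thesis
    using pos uw_pos by (cases x) (simp_all add: density_simps)
qed

lemma canonical_\<Gamma>: "canonical \<Gamma> p = 1"
  by (cases p) (simp_all add: canonical_def valence_def edge6_tail_eq edge6_head_eq)

lemma genus_\<Gamma>: "genus \<Gamma> = 3"
  by (simp add: genus_def betti_def UNIV_vertex4 UNIV_edge6)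

lemma total_length_\<Gamma>: "total_length \<Gamma> = a + b + c + d + e + f"
  by (simp add: total_length_def UNIV_edge6)

sublocale K: polarized_kernel \<Gamma> res curv
  by unfold_locales (simp_all add: density_pos canonical_\<Gamma> genus_\<Gamma>)

lemma Vertex_in_points: "Vertex p \<in> points \<Gamma>"
  by (simp add: points_def)

lemma theta_\<Gamma>: "theta \<Gamma> = (6 * ((a + b) * (u + w)) + 8 * (a * b) + 8 * (u * w)) / S"
proof -
  have "theta \<Gamma> = 2 * (res P1 P2 + res P2 P3 + res P3 P4 + res P1 P4 + res P1 P3 + res P2 P4)"
    by (simp add: theta_def canonical_\<Gamma> K.resistance_Vertex_Vertex UNIV_vertex4 res_simps)
  also have "\<dots> = (6 * ((a + b) * (u + w)) + 8 * (a * b) + 8 * (u * w)) / S"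
    using uw_pos(3) by (simp add: res_simps add_divide_distrib[symmetric]) (simp add: S_def algebra_simps)
  finally show ?thesis .
qed

lemma tau_\<Gamma>:
  assumes y: "y \<in> points \<Gamma>"
  shows "tau \<Gamma> y = total_length \<Gamma> / 12 - ((a + b) * (u + w) + 2 * (u * w)) / (6 * S)"
proof -
  \<comment> \<open>The terms of \<open>tau_eq\<close> for an edge \<open>x\<close> of the loop and for a parallel pair \<open>x\<close>, \<open>x'\<close> acting as \<open>z\<close>.\<close>
  have single: "(1 / S)\<^sup>2 * x ^ 3 = x - 2 * (x * (S - x) / S) + x * (S - x)\<^sup>2 / S\<^sup>2" for x
    using uw_pos(3) by (simp add: field_simps power2_eq_square power3_eq_cube)
  have double: "((1 - z * (S - z) / S / x) / x)\<^sup>2 * x ^ 3 + ((1 - z * (S - z) / S / x') / x')\<^sup>2 * x' ^ 3 =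
     x + x' - 4 * (z * (S - z) / S) + z * (S - z)\<^sup>2 / S\<^sup>2"
    if x: "0 < x" "0 < x'" "0 < z" and sum: "1 / x + 1 / x' = 1 / z" for x x' z
  proof -
    define \<rho> where "\<rho> = z * (S - z) / S"
    have piece: "((1 - \<rho> / x) / x)\<^sup>2 * x ^ 3 = x - 2 * \<rho> + \<rho>\<^sup>2 * (1 / x)" if "0 < x" for x
      using that by (simp add: field_simps power2_eq_square power3_eq_cube)
    have "((1 - \<rho> / x) / x)\<^sup>2 * x ^ 3 + ((1 - \<rho> / x') / x')\<^sup>2 * x' ^ 3 = x + x' - 4 * \<rho> + \<rho>\<^sup>2 * (1 / x + 1 / x')"
      unfolding piece[OF x(1)] piece[OF x(2)] by (simp add: distrib_left)
    moreover have "\<rho>\<^sup>2 * (1 / z) = z * (S - z)\<^sup>2 / S\<^sup>2"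
      using x(3) by (simp add: \<rho>_def power2_eq_square)
    ultimately show ?thesis
      unfolding sum \<rho>_def by simp
  qed
  have kirchhoff: "K.kirchhoff (Vertex P1) =
      (u + a) / S * (u * (S - u) / S) + (a + w) / S * ((u + a) * (w + b) / S) + (w + b) / S * (b * (S - b) / S)"
    by (simp add: K.kirchhoff_def UNIV_vertex4 K.profile_def res_simps curv_def)
  have "(\<Sum>x\<in>arcs (gr \<Gamma>). (K.density x)\<^sup>2 * len \<Gamma> x ^ 3) =
      (1 / S)\<^sup>2 * a ^ 3 + (1 / S)\<^sup>2 * b ^ 3 +
      (((1 - u * (S - u) / S / c) / c)\<^sup>2 * c ^ 3 + ((1 - u * (S - u) / S / d) / d)\<^sup>2 * d ^ 3) +
      (((1 - w * (S - w) / S / e) / e)\<^sup>2 * e ^ 3 + ((1 - w * (S - w) / S / f) / f)\<^sup>2 * f ^ 3)"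
    by (simp add: UNIV_edge6 density_simps)
  also have "\<dots> = total_length \<Gamma>
      - 2 * (a * (S - a) / S) + a * (S - a)\<^sup>2 / S\<^sup>2 - 2 * (b * (S - b) / S) + b * (S - b)\<^sup>2 / S\<^sup>2
      - 4 * (u * (S - u) / S) + u * (S - u)\<^sup>2 / S\<^sup>2 - 4 * (w * (S - w) / S) + w * (S - w)\<^sup>2 / S\<^sup>2"
    unfolding single double[OF pos(3,4) uw_pos(1) parallel(1)] double[OF pos(5,6) uw_pos(2) parallel(2)]
    by (simp add: total_length_\<Gamma>)
  finally have "tau \<Gamma> y = K.kirchhoff (Vertex P1) / 4 + (total_length \<Gamma>
      - 2 * (a * (S - a) / S) + a * (S - a)\<^sup>2 / S\<^sup>2 - 2 * (b * (S - b) / S) + b * (S - b)\<^sup>2 / S\<^sup>2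
      - 4 * (u * (S - u) / S) + u * (S - u)\<^sup>2 / S\<^sup>2 - 4 * (w * (S - w) / S) + w * (S - w)\<^sup>2 / S\<^sup>2) / 12"
    using K.tau_eq[OF y] K.kirchhoff_const[OF y Vertex_in_points[of P1]] by simp
  also have "\<dots> = total_length \<Gamma> / 12 - ((a + b) * (u + w) + 2 * (u * w)) / (6 * S)"
  proof -
    have "S \<noteq> 0" using uw_pos(3) by simp
    then have "12 * S\<^sup>2 * (K.kirchhoff (Vertex P1) / 4 + (total_length \<Gamma>
      - 2 * (a * (S - a) / S) + a * (S - a)\<^sup>2 / S\<^sup>2 - 2 * (b * (S - b) / S) + b * (S - b)\<^sup>2 / S\<^sup>2
      - 4 * (u * (S - u) / S) + u * (S - u)\<^sup>2 / S\<^sup>2 - 4 * (w * (S - w) / S) + w * (S - w)\<^sup>2 / S\<^sup>2) / 12) =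
      3 * ((u + a) * (u * (S - u)) + (a + w) * ((u + a) * (w + b)) + (w + b) * (b * (S - b))) + total_length \<Gamma> * S\<^sup>2
      - 2 * (a * (S - a) * S) + a * (S - a)\<^sup>2 - 2 * (b * (S - b) * S) + b * (S - b)\<^sup>2
      - 4 * (u * (S - u) * S) + u * (S - u)\<^sup>2 - 4 * (w * (S - w) * S) + w * (S - w)\<^sup>2"
      unfolding kirchhoff by (simp add: field_simps power2_eq_square)
    also have "\<dots> = total_length \<Gamma> * S\<^sup>2 - 2 * ((a + b) * (u + w) + 2 * (u * w)) * S"
      unfolding S_def by (simp add: algebra_simps power2_eq_square)
    also have "\<dots> = 12 * S\<^sup>2 * (total_length \<Gamma> / 12 - ((a + b) * (u + w) + 2 * (u * w)) / (6 * S))"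
      using \<open>S \<noteq> 0\<close> by (simp add: field_simps power2_eq_square)
    finally show ?thesis using \<open>S \<noteq> 0\<close> by simp
  qed
  finally show ?thesis .
qed

end

text \<open>All quotients in the claim simplify to the loop parameters: with \<open>N = (c + d) * (e + f)\<close> the
  polynomials \<open>A\<close>, \<open>B\<close>, \<open>C\<close>, \<open>D\<close> are \<open>N\<close> times \<open>(a + b) * (u + w)\<close>, \<open>a * b\<close>, \<open>u * w\<close>, \<open>S\<close>.\<close>

theorem mainTheorem6:
  fixes a b c d e f A B C D :: real and \<Gamma> :: "(vertex4, edge6) metrized"
  assumes pos: "0 < a" "0 < b" "0 < c" "0 < d" "0 < e" "0 < f"
    and \<Gamma>: "\<Gamma> = two_double_edges a b c d e f"
    and A: "A = a*c*d*e + b*c*d*e + a*c*d*f + b*c*d*f + a*c*e*f + b*c*e*f + a*d*e*f + b*d*e*f"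
    and B: "B = a*b*c*e + a*b*d*e + a*b*c*f + a*b*d*f"
    and C: "C = c*d*e*f"
    and D: "D = (a+b)*c*e + (a+b)*d*e + c*d*e + (a+b)*c*f + (a+b)*d*f + c*d*f + c*e*f + d*e*f"
  shows "polarized_metrized_graph \<Gamma>
    \<and> genus \<Gamma> = 3
    \<and> total_length \<Gamma> = a + b + c + d + e + f
    \<and> delta_inv \<Gamma> 0 = total_length \<Gamma>
    \<and> delta_inv \<Gamma> 1 = 0
    \<and> (\<forall>y\<in>points \<Gamma>. tau \<Gamma> y = total_length \<Gamma> / 12 - (A + 2*C) / (6*D))
    \<and> theta \<Gamma> = (6*A + 8*B + 8*C) / D
    \<and> phi_inv \<Gamma> = total_length \<Gamma> / 9 - (2*A - 6*B + 7*C) / (9*D)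
    \<and> lambda_inv \<Gamma> = 3 * total_length \<Gamma> / 28 + (A + 4*B) / (28*D)
    \<and> epsilon_inv \<Gamma> = 2 / 9 * total_length \<Gamma> + (5*A + 12*B + 4*C) / (9*D)"
proof -
  interpret double_edges a b c d e f by unfold_locales (fact pos)+
  note \<Gamma>[simp]
  define X Y Z N where "X = (a + b) * (u + w) / S" and "Y = a * b / S" and "Z = u * w / S" and "N = (c + d) * (e + f)"
  have cd: "c * d = u * (c + d)" and ef: "e * f = w * (e + f)"
    using pos by (simp_all add: u_def w_def)
  have N: "N \<noteq> 0" using pos by (simp add: N_def)
  have D': "D = N * S"
  proof -
    have "D = (a + b) * N + c * d * (e + f) + e * f * (c + d)"
      unfolding D N_def by (simp add: algebra_simps)
    also have "\<dots> = N * S"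
      unfolding cd ef N_def S_def by (simp add: algebra_simps)
    finally show ?thesis .
  qed
  have A': "A = N * S * X"
  proof -
    have "A = (a + b) * (c * d * (e + f) + e * f * (c + d))"
      unfolding A by (simp add: algebra_simps)
    also have "\<dots> = N * ((a + b) * (u + w))"
      unfolding cd ef N_def by (simp add: algebra_simps)
    finally show ?thesis using uw_pos(3) by (simp add: X_def)
  qed
  have B': "B = N * S * Y"
    unfolding B N_def Y_def using uw_pos(3) by (simp add: algebra_simps)
  have C': "C = N * S * Z"
  proof -
    have "C = (c * d) * (e * f)" unfolding C by simp
    also have "\<dots> = N * (u * w)" unfolding cd ef N_def by simp
    finally show ?thesis using uw_pos(3) by (simp add: Z_def)
  qed
  have quot: "(k * A + l * B + m * C) / (n * D) = (k * X + l * Y + m * Z) / n" for k l m n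
  proof -
    have "(k * A + l * B + m * C) / (n * D) = (N * S) * (k * X + l * Y + m * Z) / ((N * S) * n)"
      unfolding A' B' C' D' by (simp add: algebra_simps)
    then show ?thesis using N uw_pos(3) by simp
  qed
  have tau: "tau \<Gamma> y = total_length \<Gamma> / 12 - (X + 2 * Z) / 6" if "y \<in> points \<Gamma>" for y
    using tau_\<Gamma> that by (simp add: X_def Z_def add_divide_distrib)
  have theta: "theta \<Gamma> = 6 * X + 8 * Y + 8 * Z"
    by (simp add: theta_\<Gamma> X_def Y_def Z_def add_divide_distrib)
  have eps: "epsilon_inv \<Gamma> = 2 / 9 * total_length \<Gamma> + (5 * X + 12 * Y + 4 * Z) / 9"
    using K.epsilon_eq[OF Vertex_in_points[of P1]] tau[of "Vertex P1"] theta Vertex_in_points[of P1]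
    by (simp add: genus_\<Gamma> field_simps)
  have zed: "Z_inv \<Gamma> = (2 * (total_length \<Gamma> / 12 - (X + 2 * Z) / 6) + epsilon_inv \<Gamma> / 2) / 6"
    using K.Z_eq[OF Vertex_in_points[of P1]] tau[of "Vertex P1"] Vertex_in_points[of P1]
    by (simp add: genus_\<Gamma>)
  have gen: "genus \<Gamma> = 3" by (simp add: genus_\<Gamma>)
  have phi: "phi_inv \<Gamma> = total_length \<Gamma> / 9 - (2 * X - 6 * Y + 7 * Z) / 9"
    unfolding phi_inv_def zed eps gen by (simp add: field_simps)
  have lambda: "lambda_inv \<Gamma> = 3 * total_length \<Gamma> / 28 + (X + 4 * Y) / 28"
    unfolding lambda_inv_def phi eps gen by (simp add: field_simps)
  have "polarized_metrized_graph \<Gamma>"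
    using fin_\<Gamma> connected_\<Gamma> K.len_pos by (simp add: polarized_metrized_graph_def metrized_graph_def canonical_\<Gamma>)
  moreover have "delta_inv \<Gamma> 0 = total_length \<Gamma>"
    using fin_\<Gamma> K.len_pos connected_cut by (simp add: delta_inv_0)
  moreover have "delta_inv \<Gamma> 1 = 0"
    using connected_cut by (simp add: delta_inv_pos)
  moreover have "(A + 2 * C) / (6 * D) = (X + 2 * Z) / 6" "(6 * A + 8 * B + 8 * C) / D = 6 * X + 8 * Y + 8 * Z"
    "(2 * A - 6 * B + 7 * C) / (9 * D) = (2 * X - 6 * Y + 7 * Z) / 9" "(A + 4 * B) / (28 * D) = (X + 4 * Y) / 28"
    "(5 * A + 12 * B + 4 * C) / (9 * D) = (5 * X + 12 * Y + 4 * Z) / 9"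
    using quot[of 1 0 2 6] quot[of 6 8 8 1] quot[of 2 "-6" 7 9] quot[of 1 4 0 28] quot[of 5 12 4 9] by simp_all
  ultimately show ?thesis
    using tau theta phi lambda eps gen total_length_\<Gamma> by simp
qed

end
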